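(* Let $p>3$ be a prime and let $k$ be an integer. Set $h=\frac{1}{2}\gcd(p-1,24)$. Then there exist integers $r_1,r_p$ such that $f(z)=\eta^{r_1}(z)\eta^{r_p}(pz)$ is a weakly holomorphic modular form of weight $k$ on $\Gamma_1(p)$ if and only if $h$ divides $k$.
   Context: $\eta(z)=q^{1/24}\prod_{n\ge1}(1-q^n)$ with $q=e^{2\pi i z}$, $z$ in the upper half plane, is the Dedekind eta-function. $\Gamma_1(p)=\{\begin{pmatrix}a&b\\c&d\end{pmatrix}\in \mathrm{SL}_2(\mathbb{Z}) : a\equiv d\equiv 1,\ c\equiv 0 \pmod p\}$. A weakly holomorphic modular form of weight $k$ on $\Gamma_1(p)$ is a function $f$ holomorphic on the upper half plane with $(cz+d)^{-k}f\left(\frac{az+b}{cz+d}\right)=f(z)$ for all $\begin{pmatrix}a&b\\c&d\end{pmatrix}\in\Gamma_1(p)$, which is meromorphic at every cusp of $\Gamma_1(p)$ (its Fourier expansion at each cusp has only finitely many negative-power terms). *)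

theory Defs
  imports "HOL-Complex_Analysis.Complex_Analysis" "HOL-Number_Theory.Cong"
begin

definition upper_half_plane :: "complex set" where
  "upper_half_plane = {z. Im z > 0}"

definition dedekind_eta :: "complex \<Rightarrow> complex" where
  "dedekind_eta z =
     exp (2 * of_real pi * \<i> * z / 24) * (\<Prod>n. 1 - exp (2 * of_real pi * \<i> * z) ^ Suc n)"

definition SL2Z :: "(int ^ 2 ^ 2) set" where
  "SL2Z = {A. det A = 1}"

definition Gamma1 :: "nat \<Rightarrow> (int ^ 2 ^ 2) set" where
  "Gamma1 N = {A \<in> SL2Z. [A $ 1 $ 1 = 1] (mod int N) \<and> [A $ 2 $ 2 = 1] (mod int N) \<and>
                        [A $ 2 $ 1 = 0] (mod int N)}"

text \<open>The weight \<open>k\<close> action \<open>(f | A)(z) = (c z + d) powi (- k) * f((a z + b) / (c z + d))\<close>.\<close>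

definition slash :: "int \<Rightarrow> (complex \<Rightarrow> complex) \<Rightarrow> int ^ 2 ^ 2 \<Rightarrow> complex \<Rightarrow> complex" where
  "slash k f A z =
     (of_int (A $ 2 $ 1) * z + of_int (A $ 2 $ 2)) powi (- k) *
     f ((of_int (A $ 1 $ 1) * z + of_int (A $ 1 $ 2)) / (of_int (A $ 2 $ 1) * z + of_int (A $ 2 $ 2)))"

text \<open>Every cusp of \<open>Gamma1 N\<close> is \<open>A \<infinity>\<close> for some \<open>A\<close> in \<open>SL2Z\<close>, and the Fourier expansion of
  \<open>f\<close> at that cusp is the expansion of \<open>slash k f A\<close> at \<open>\<infinity>\<close>. All these expansions are taken in
  \<open>exp (2 \<pi> \<i> z / N)\<close>. This suffices because every conjugate of \<open>Gamma1 N\<close> in \<open>SL2Z\<close> contains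
  the translation by \<open>N\<close>.\<close>

definition meromorphic_at_cusps :: "nat \<Rightarrow> int \<Rightarrow> (complex \<Rightarrow> complex) \<Rightarrow> bool" where
  "meromorphic_at_cusps N k f \<longleftrightarrow>
     (\<forall>A\<in>SL2Z. \<exists>a :: int \<Rightarrow> complex. finite {n. n < 0 \<and> a n \<noteq> 0} \<and>
        (\<forall>z\<in>upper_half_plane.
           ((\<lambda>n. a n * exp (2 * of_real pi * \<i> * of_int n * z / of_nat N)) has_sum slash k f A z) UNIV))"

definition weakly_holomorphic_modular_form :: "nat \<Rightarrow> int \<Rightarrow> (complex \<Rightarrow> complex) \<Rightarrow> bool" where
  "weakly_holomorphic_modular_form N k f \<longleftrightarrow>
     f holomorphic_on upper_half_plane \<and>
     (\<forall>A\<in>Gamma1 N. \<forall>z\<in>upper_half_plane. slash k f A z = f z) \<and>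
     meromorphic_at_cusps N k f"

end

theory Submission imports Defs begin

text \<open>
  The theta quotient \<open>kphi u t\<close> (a multiple of \<open>\<theta>\<^sub>1(u, t) / \<eta>(t)\<^sup>3\<close>) is determined by its
  quasi-periodicity and its derivative at 0, by Liouville's theorem. Hence it transforms in a simple way under
  every element of \<open>SL\<^sub>2(\<int>)\<close>, and so do the Klein forms \<open>klein x y\<close>, which have weight \<open>-1\<close> and
  depend on \<open>(x, y)\<close> modulo \<open>\<int>\<^sup>2\<close> only up to explicit roots of unity. The product of the three Klein forms at the half periods
  is a multiple of \<open>\<eta>\<^sup>-\<^sup>6\<close>, which gives the modularity of \<open>\<eta>\<^sup>2\<^sup>4\<close>. For \<open>p = 2 h + 1\<close> one has
  \<open>\<eta>(t) = \<plusminus> \<eta>(p t)\<^sup>p \<Prod>j=1..h. klein (j / p) 0 (p t)\<close>, so if \<open>r + s = 2 k\<close> and \<open>p r + s = 24 m\<close>, then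
  \<open>\<eta>(t)\<^sup>r \<eta>(p t)\<^sup>s\<close> is, up to sign, the \<open>m\<close>-th power of \<open>\<eta>(p t)\<^sup>2\<^sup>4\<close> times the \<open>r\<close>-th power of that
  product. On \<open>\<Gamma>\<^sub>1(p)\<close> the roots of unity of the product cancel, so no formula for the multiplier of \<open>\<eta>\<close>
  is needed. At the cusps it is enough to bound the absolute value. Conversely, the translation by 1 forces
  \<open>24 dvd r + p s\<close>, and absolute values at one other element of \<open>\<Gamma>\<^sub>1(p)\<close> force \<open>r + s = 2 k\<close>.
\<close>

section \<open>Infinite q-products\<close>

text \<open>The q-Pochhammer symbol \<open>(x q; q)\<close> of infinite length. The exponents start
  at 1, so \<open>qprod 1 q\<close> is the Euler product in \<open>\<eta>\<close>.\<close>

definition qprod :: "complex \<Rightarrow> complex \<Rightarrow> complex" where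
  "qprod x q = (\<Prod>n. 1 - x * q ^ Suc n)"

lemma summable_norm_qprod:
  assumes "norm q < 1"
  shows "summable (\<lambda>n. norm (x * q ^ Suc n :: complex))"
proof -
  have "summable (\<lambda>n. norm (x * q) * norm q ^ n)"
    by (intro summable_mult summable_geometric) (use assms in auto)
  thus ?thesis by (simp add: norm_mult norm_power mult_ac)
qed

lemma convergent_prod_qprod:
  assumes "norm q < 1"
  shows "convergent_prod (\<lambda>n. 1 - x * q ^ Suc n :: complex)"
  using summable_imp_abs_convergent_prod[of "\<lambda>n. 1 - x * q ^ Suc n"] summable_norm_qprod[OF assms, of x]
  by (intro abs_convergent_prod_imp_convergent_prod) (simp add: norm_minus_commute)

lemma qprod_LIMSEQ:
  assumes "norm q < 1"
  shows "(\<lambda>N. \<Prod>n<N. 1 - x * q ^ Suc n) \<longlonglongrightarrow> qprod x q"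
  using convergent_prod_LIMSEQ[OF convergent_prod_qprod[OF assms, of x]]
  unfolding qprod_def by (subst LIMSEQ_lessThan_iff_atMost) auto

text \<open>\<open>convergent_prod\<close> tolerates finitely many zero factors and asks for a
  nonzero limit of the rest, so the product vanishes only if a factor does.\<close>

lemma qprod_eq_0_iff:
  assumes "norm q < 1"
  shows "qprod x q = 0 \<longleftrightarrow> (\<exists>n. x * q ^ Suc n = 1)"
proof -
  have "(\<lambda>n. 1 - x * q ^ Suc n) has_prod qprod x q"
    unfolding qprod_def using convergent_prod_qprod[OF assms] by (rule convergent_prod_has_prod)
  from has_prod_eq_0_iff[OF this] show ?thesis by auto
qed

lemma qprod_one_nonzero:
  assumes "norm q < 1"
  shows "qprod 1 q \<noteq> 0"
proof -
  have "q ^ Suc n \<noteq> 1" for n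
    using power_less_one_iff[of "norm q" "Suc n"] assms by (metis norm_ge_zero norm_one norm_power order_less_irrefl zero_less_Suc)
  thus ?thesis by (simp add: qprod_eq_0_iff[OF assms])
qed

text \<open>The first factor is split off and the others are reindexed. This functional equation is
  the source of the quasi-periodicity of \<open>kphi\<close> under translation by
  \<open>t\<close>.\<close>

lemma qprod_rec:
  assumes "norm q < 1"
  shows "qprod x q = (1 - x * q) * qprod (x * q) q"
proof (rule LIMSEQ_unique)
  show "(\<lambda>N. \<Prod>n<Suc N. 1 - x * q ^ Suc n) \<longlonglongrightarrow> qprod x q"
    using qprod_LIMSEQ[OF assms] by (subst filterlim_sequentially_Suc)
  have "(\<Prod>n<Suc N. 1 - x * q ^ Suc n) = (1 - x * q) * (\<Prod>n<N. 1 - (x * q) * q ^ Suc n)" for N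
    by (subst prod.lessThan_Suc_shift) (simp add: mult_ac)
  thus "(\<lambda>N. \<Prod>n<Suc N. 1 - x * q ^ Suc n) \<longlonglongrightarrow> (1 - x * q) * qprod (x * q) q"
    by (simp only:) (intro tendsto_intros qprod_LIMSEQ assms)
qed

text \<open>The exponents of \<open>q\<close> are grouped by residue class modulo \<open>N\<close>:
  the exponent \<open>N (n + 1) - j\<close> belongs to the factor with \<open>x / q ^ j\<close> and
  nome \<open>q ^ N\<close>.\<close>

lemma qprod_split:
  assumes "norm q < 1" "q \<noteq> 0" "N > 0"
  shows "qprod x q = (\<Prod>j<N. qprod (x / q ^ j) (q ^ N))"
proof (rule LIMSEQ_unique)
  have qN: "norm (q ^ N) < 1"
    using assms by (simp add: norm_power power_less_one_iff)
  show "(\<lambda>M. \<Prod>j<N. \<Prod>n<M. 1 - (x / q ^ j) * (q ^ N) ^ Suc n) \<longlonglongrightarrow> (\<Prod>j<N. qprod (x / q ^ j) (q ^ N))"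
    by (intro tendsto_prod qprod_LIMSEQ qN)
  \<comment> \<open>For fixed \<open>n\<close> the \<open>N\<close> factors form a block of
    consecutive exponents, traversed in reverse order.\<close>
  have *: "(\<Prod>j<N. 1 - (x / q ^ j) * (q ^ N) ^ Suc n) = (\<Prod>i = n * N..<n * N + N. 1 - x * q ^ Suc i)" for n
  proof (rule prod.reindex_bij_witness[of _ "\<lambda>i. N * Suc n - Suc i" "\<lambda>j. N * Suc n - Suc j"])
    fix j assume j: "j \<in> {..<N}"
    have "(q ^ N) ^ Suc n = q ^ j * q ^ Suc (N * Suc n - Suc j)"
      using j by (simp add: power_add [symmetric] power_mult [symmetric] del: power_Suc)
    thus "1 - x * q ^ Suc (N * Suc n - Suc j) = 1 - (x / q ^ j) * (q ^ N) ^ Suc n"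
      using assms by (simp del: power_Suc)
  qed (auto simp: algebra_simps)
  have "(\<Prod>j<N. \<Prod>n<M. 1 - (x / q ^ j) * (q ^ N) ^ Suc n) = (\<Prod>i<M * N. 1 - x * q ^ Suc i)" for M
  proof -
    have "(\<Prod>j<N. \<Prod>n<M. 1 - (x / q ^ j) * (q ^ N) ^ Suc n) = (\<Prod>n<M. \<Prod>i = n * N..<n * N + N. 1 - x * q ^ Suc i)"
      by (subst prod.swap) (simp only: *)
    also have "\<dots> = (\<Prod>i<M * N. 1 - x * q ^ Suc i)"
      by (rule prod.nat_group)
    finally show ?thesis .
  qed
  moreover have "(\<lambda>M. \<Prod>i<M * N. 1 - x * q ^ Suc i) \<longlonglongrightarrow> qprod x q"
    using LIMSEQ_subseq_LIMSEQ[OF qprod_LIMSEQ[OF assms(1)], of "\<lambda>M. M * N"] assms(3)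
    by (auto simp: strict_mono_def o_def)
  ultimately show "(\<lambda>M. \<Prod>j<N. \<Prod>n<M. 1 - (x / q ^ j) * (q ^ N) ^ Suc n) \<longlonglongrightarrow> qprod x q"
    by simp
qed

lemma qprod_mult_minus:
  assumes "norm q < 1"
  shows "qprod x q * qprod (- x) q = qprod (x\<^sup>2) (q\<^sup>2)"
proof (rule LIMSEQ_unique)
  have q2: "norm (q\<^sup>2) < 1"
    using assms by (simp add: norm_power power_less_one_iff)
  show "(\<lambda>N. (\<Prod>n<N. 1 - x * q ^ Suc n) * (\<Prod>n<N. 1 - (-x) * q ^ Suc n)) \<longlonglongrightarrow> qprod x q * qprod (- x) q"
    by (intro tendsto_intros qprod_LIMSEQ assms)
  have "(1 - x * q ^ Suc n) * (1 - (-x) * q ^ Suc n) = 1 - x\<^sup>2 * (q\<^sup>2) ^ Suc n" for n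
    by (simp add: algebra_simps power2_eq_square power_mult_distrib)
  thus "(\<lambda>N. (\<Prod>n<N. 1 - x * q ^ Suc n) * (\<Prod>n<N. 1 - (-x) * q ^ Suc n)) \<longlonglongrightarrow> qprod (x\<^sup>2) (q\<^sup>2)"
    unfolding prod.distrib [symmetric] by (simp only:) (rule qprod_LIMSEQ[OF q2])
qed

text \<open>The partial products converge locally uniformly: on a closed disc the terms are
  dominated by the geometric series \<open>B * r ^ Suc n\<close>.\<close>

lemma holomorphic_on_qprod [holomorphic_intros]:
  assumes f: "f holomorphic_on S" and g: "g holomorphic_on S" and "open S"
    and less: "\<And>z. z \<in> S \<Longrightarrow> norm (g z) < 1"
  shows "(\<lambda>z. qprod (f z) (g z)) holomorphic_on S"
proof (rule holomorphic_uniform_sequence[OF \<open>open S\<close>])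
  show "(\<lambda>z. \<Prod>n<N. 1 - f z * g z ^ Suc n) holomorphic_on S" for N
    by (intro holomorphic_intros f g)
  fix z assume "z \<in> S"
  then obtain e where e: "e > 0" "cball z e \<subseteq> S"
    using \<open>open S\<close> open_contains_cball by blast
  have contf: "continuous_on (cball z e) f" and contg: "continuous_on (cball z e) g"
    using f g e holomorphic_on_imp_continuous_on continuous_on_subset by blast+
  have "bounded (f ` cball z e)"
    by (intro compact_imp_bounded compact_continuous_image contf) auto
  then obtain B where B: "\<And>x. x \<in> cball z e \<Longrightarrow> norm (f x) \<le> B"
    unfolding bounded_iff by blast
  \<comment> \<open>The maximum is attained, so the bound for \<open>norm (g x)\<close> on the disc
    is strictly below 1.\<close>
  obtain x0 where x0: "x0 \<in> cball z e" "\<And>x. x \<in> cball z e \<Longrightarrow> norm (g x) \<le> norm (g x0)"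
    using continuous_attains_sup[of "cball z e" "\<lambda>x. norm (g x)"] continuous_on_norm[OF contg] e
    by (metis centre_in_cball compact_cball empty_iff less_imp_le)
  define r where "r = norm (g x0)"
  have r: "0 \<le> r" "r < 1" "\<And>x. x \<in> cball z e \<Longrightarrow> norm (g x) \<le> r"
    using x0 less e by (auto simp: r_def)
  have B0: "B \<ge> 0"
    using B[of z] e norm_ge_zero[of "f z"] by (meson centre_in_cball less_imp_le order_trans)
  have "uniformly_convergent_on (cball z e) (\<lambda>N x. \<Prod>n<N. 1 - f x * g x ^ Suc n)"
  proof (rule uniformly_convergent_on_prod')
    show "uniformly_convergent_on (cball z e) (\<lambda>N x. \<Sum>n<N. norm (1 - f x * g x ^ Suc n - 1))"
    proof (rule Weierstrass_m_test')
      show "norm (norm (1 - f x * g x ^ Suc n - 1)) \<le> B * r ^ Suc n" if "x \<in> cball z e" for x n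
        using B[OF that] r(3)[OF that] r(1) B0
        by (simp add: norm_mult norm_power del: power_Suc) (intro mult_mono power_mono; simp)
      show "summable (\<lambda>n. B * r ^ Suc n)"
        using r by (intro summable_mult) (simp add: summable_geometric)
    qed
  qed (use contf contg in \<open>auto intro!: continuous_intros\<close>)
  then obtain l where l: "uniform_limit (cball z e) (\<lambda>N x. \<Prod>n<N. 1 - f x * g x ^ Suc n) l sequentially"
    by (auto simp: uniformly_convergent_on_def)
  have "l x = qprod (f x) (g x)" if "x \<in> cball z e" for x
  proof (rule LIMSEQ_unique)
    show "(\<lambda>N. \<Prod>n<N. 1 - f x * g x ^ Suc n) \<longlonglongrightarrow> l x"
      by (rule tendsto_uniform_limitI[OF l that])
    show "(\<lambda>N. \<Prod>n<N. 1 - f x * g x ^ Suc n) \<longlonglongrightarrow> qprod (f x) (g x)"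
      by (rule qprod_LIMSEQ, rule less) (use e that in auto)
  qed
  hence "uniform_limit (cball z e) (\<lambda>N x. \<Prod>n<N. 1 - f x * g x ^ Suc n) (\<lambda>x. qprod (f x) (g x)) sequentially"
    by (intro uniform_limit_cong'[THEN iffD1, OF _ _ l]) auto
  thus "\<exists>d>0. cball z d \<subseteq> S \<and> uniform_limit (cball z d) (\<lambda>N x. \<Prod>n<N. 1 - f x * g x ^ Suc n) (\<lambda>x. qprod (f x) (g x)) sequentially"
    using e by blast
qed

section \<open>The theta quotient\<close>

definition e2pi :: "complex \<Rightarrow> complex" where
  "e2pi z = exp (2 * of_real pi * \<i> * z)"

lemma e2pi_add: "e2pi (z + w) = e2pi z * e2pi w"
  by (simp add: e2pi_def exp_add [symmetric] algebra_simps)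

lemma e2pi_0 [simp]: "e2pi 0 = 1"
  by (simp add: e2pi_def)

lemma e2pi_minus: "e2pi (- z) = inverse (e2pi z)"
  by (simp add: e2pi_def exp_minus)

lemma e2pi_diff: "e2pi (z - w) = e2pi z / e2pi w"
  using e2pi_add[of z "- w"] by (simp add: e2pi_minus field_simps)

lemma e2pi_nonzero [simp]: "e2pi z \<noteq> 0"
  by (simp add: e2pi_def)

lemma e2pi_eq_1_iff: "e2pi z = 1 \<longleftrightarrow> (\<exists>n::int. z = of_int n)"
proof -
  have "e2pi z = 1 \<longleftrightarrow> (\<exists>n::int. 2 * of_real pi * \<i> * z = 2 * of_real pi * \<i> * of_int n)"
    unfolding e2pi_def exp_eq_1 by (auto simp: complex_eq_iff)
  thus ?thesis by simp
qed

lemma e2pi_of_int [simp]: "e2pi (of_int n) = 1"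
  by (auto simp: e2pi_eq_1_iff)

lemma e2pi_1 [simp]: "e2pi 1 = 1"
  using e2pi_of_int[of 1] by simp

lemma e2pi_half [simp]: "e2pi (1 / 2) = -1"
  by (simp add: e2pi_def)

lemma e2pi_power: "e2pi z ^ n = e2pi (of_nat n * z)"
  by (simp add: e2pi_def exp_of_nat_mult [symmetric] algebra_simps)

lemma e2pi_power_int: "e2pi z powi n = e2pi (of_int n * z)"
  by (simp add: e2pi_def exp_power_int algebra_simps)

lemma e2pi_half_int_odd:
  assumes "odd n"
  shows "e2pi (of_int n / 2) = -1"
proof -
  obtain k where "n = 2 * k + 1" using assms by (rule oddE)
  hence "(of_int n / 2 :: complex) = of_int k + 1 / 2" by (simp add: field_simps)
  thus ?thesis by (simp only: e2pi_add) simp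
qed

lemma norm_e2pi: "norm (e2pi z) = exp (- 2 * pi * Im z)"
  by (simp add: e2pi_def)

lemma norm_e2pi_less_1: "Im t > 0 \<Longrightarrow> norm (e2pi t) < 1"
  by (simp add: norm_e2pi)

lemma holomorphic_on_e2pi [holomorphic_intros]:
  "f holomorphic_on S \<Longrightarrow> (\<lambda>z. e2pi (f z)) holomorphic_on S"
  unfolding e2pi_def by (intro holomorphic_intros)

section \<open>Quasi-periodicity and zeros of the theta quotient\<close>

text \<open>The Jacobi triple product form of theta, odd in \<open>u\<close>; the denominator
  normalises the derivative at 0 to \<open>2 \<pi> \<i>\<close>.\<close>

definition kphi :: "complex \<Rightarrow> complex \<Rightarrow> complex" where
  "kphi u t = (e2pi (u / 2) - e2pi (- u / 2)) * qprod (e2pi u) (e2pi t) * qprod (e2pi (- u)) (e2pi t) / (qprod 1 (e2pi t))\<^sup>2"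

lemma kphi_add_1: "kphi (u + 1) t = - kphi u t"
proof -
  have "e2pi ((u + 1) / 2) = - e2pi (u / 2)"
    by (simp add: add_divide_distrib e2pi_add)
  moreover have "e2pi (- (u + 1) / 2) = - e2pi (- u / 2)"
    using calculation unfolding minus_divide_left [symmetric] e2pi_minus by simp
  moreover have "e2pi (- (u + 1)) = e2pi (- u)"
    by (simp only: e2pi_minus e2pi_add) simp
  moreover have "- X - - Y = - (X - Y)" for X Y :: complex
    by simp
  ultimately show ?thesis
    unfolding kphi_def by (simp only: e2pi_add e2pi_1 mult_1_right mult_minus_left minus_divide_left)
qed

text \<open>Under this translation one \<open>qprod\<close> loses a factor and the other gains one,
  by \<open>qprod_rec\<close>; the two factors and the change of the prefactor combine to the
  multiplier.\<close>

lemma kphi_add_tau: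
  assumes "Im t > 0"
  shows "kphi (u + t) t = - e2pi (- u - t / 2) * kphi u t"
proof -
  \<comment> \<open>With these square roots of \<open>e2pi u\<close> and \<open>e2pi t\<close> every
    exponential becomes a monomial in \<open>s\<close> and \<open>r\<close>.\<close>
  define s where "s = e2pi (u / 2)"
  define r where "r = e2pi (t / 2)"
  have nz: "s \<noteq> 0" "r \<noteq> 0" by (auto simp: s_def r_def)
  have eqs: "e2pi u = s\<^sup>2" "e2pi t = r\<^sup>2" "e2pi (- u) = 1 / s\<^sup>2" "e2pi (- u / 2) = 1 / s"
      "e2pi ((u + t) / 2) = s * r" "e2pi (- (u + t) / 2) = 1 / (s * r)" "e2pi (u + t) = s\<^sup>2 * r\<^sup>2"
      "e2pi (- (u + t)) = 1 / (s\<^sup>2 * r\<^sup>2)" "e2pi (- u - t / 2) = 1 / (s\<^sup>2 * r)"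
  proof -
    have u: "e2pi u = s\<^sup>2" and t: "e2pi t = r\<^sup>2"
      by (simp_all add: s_def r_def e2pi_power)
    have ut: "e2pi ((u + t) / 2) = s * r"
      by (simp add: s_def r_def add_divide_distrib e2pi_add)
    have inv: "e2pi (- (u + t) / 2) = inverse (e2pi ((u + t) / 2))" "e2pi (- u / 2) = inverse s"
      unfolding s_def e2pi_minus [symmetric] by (simp_all only: minus_divide_left)
    show "e2pi u = s\<^sup>2" "e2pi t = r\<^sup>2" "e2pi (- u) = 1 / s\<^sup>2" "e2pi (- u / 2) = 1 / s"
      "e2pi ((u + t) / 2) = s * r" "e2pi (- (u + t) / 2) = 1 / (s * r)" "e2pi (u + t) = s\<^sup>2 * r\<^sup>2"
      "e2pi (- (u + t)) = 1 / (s\<^sup>2 * r\<^sup>2)" "e2pi (- u - t / 2) = 1 / (s\<^sup>2 * r)"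
      unfolding inv ut e2pi_diff e2pi_minus e2pi_add u t by (simp_all add: inverse_eq_divide r_def)
  qed
  have less: "norm (r\<^sup>2) < 1"
    using norm_e2pi_less_1[OF assms] eqs by simp
  have 1: "qprod (s\<^sup>2) (r\<^sup>2) = (1 - s\<^sup>2 * r\<^sup>2) * qprod (s\<^sup>2 * r\<^sup>2) (r\<^sup>2)"
    by (rule qprod_rec[OF less])
  have 2: "qprod (1 / (s\<^sup>2 * r\<^sup>2)) (r\<^sup>2) = (1 - 1 / s\<^sup>2) * qprod (1 / s\<^sup>2) (r\<^sup>2)"
    using qprod_rec[OF less, of "1 / (s\<^sup>2 * r\<^sup>2)"] nz by simp
  \<comment> \<open>Kept as a product, since \<open>1 - s\<^sup>2 * r\<^sup>2\<close> may vanish and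
    cannot be divided out.\<close>
  have 3: "(s * r - 1 / (s * r)) * qprod (s\<^sup>2 * r\<^sup>2) (r\<^sup>2) = - qprod (s\<^sup>2) (r\<^sup>2) / (s * r)"
    using nz unfolding 1 by (simp add: field_simps power2_eq_square)
  have "kphi (u + t) t = ((s * r - 1 / (s * r)) * qprod (s\<^sup>2 * r\<^sup>2) (r\<^sup>2)) * ((1 - 1 / s\<^sup>2) * qprod (1 / s\<^sup>2) (r\<^sup>2)) / (qprod 1 (r\<^sup>2))\<^sup>2"
    unfolding kphi_def eqs 2 by (simp add: mult_ac)
  also have "\<dots> = - (1 / (s\<^sup>2 * r)) * ((s - 1 / s) * qprod (s\<^sup>2) (r\<^sup>2) * qprod (1 / s\<^sup>2) (r\<^sup>2) / (qprod 1 (r\<^sup>2))\<^sup>2)"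
  proof -
    have *: "- X / (s * r) * ((1 - 1 / s\<^sup>2) * Y) = - (1 / (s\<^sup>2 * r)) * ((s - 1 / s) * X * Y)" for X Y
      using nz by (simp add: field_simps power2_eq_square)
    show ?thesis
      unfolding 3 * by simp
  qed
  also have "\<dots> = - e2pi (- u - t / 2) * kphi u t"
    unfolding kphi_def eqs by (simp add: s_def)
  finally show ?thesis .
qed

lemma kphi_add_int: "kphi (u + of_int n) t = e2pi (of_int n / 2) * kphi u t"
proof (induction n rule: int_induct[where k = 0])
  case (step1 i)
  have "kphi (u + of_int (i + 1)) t = - kphi (u + of_int i) t"
    using kphi_add_1[of "u + of_int i"] by (simp add: add_ac)
  thus ?case using step1 by (simp add: add_divide_distrib e2pi_add)
next
  case (step2 i)
  have "kphi (u + of_int i) t = - kphi (u + of_int (i - 1)) t"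
    using kphi_add_1[of "u + of_int (i - 1)"] by (simp add: add_ac)
  thus ?case using step2 by (simp add: diff_divide_distrib e2pi_diff)
qed auto

text \<open>Iterating \<open>kphi_add_tau\<close> sums an arithmetic progression of exponents, hence
  the quadratic term. Each sign is carried as \<open>e2pi (1 / 2)\<close>.\<close>

lemma kphi_add_int_tau:
  assumes "Im t > 0"
  shows "kphi (u + of_int n * t) t = e2pi (of_int n / 2 - (of_int n)\<^sup>2 * t / 2 - of_int n * u) * kphi u t"
proof (induction n rule: int_induct[where k = 0])
  case (step1 i)
  have "kphi (u + of_int (i + 1) * t) t = e2pi (1/2) * e2pi (- (u + of_int i * t) - t / 2) * kphi (u + of_int i * t) t"
    using kphi_add_tau[OF assms, of "u + of_int i * t"] by (simp add: algebra_simps)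
  also have "\<dots> = e2pi (1/2 + (- (u + of_int i * t) - t / 2) + (of_int i / 2 - (of_int i)\<^sup>2 * t / 2 - of_int i * u)) * kphi u t"
    by (simp only: step1 e2pi_add mult.assoc)
  also have "(1/2 + (- (u + of_int i * t) - t / 2) + (of_int i / 2 - (of_int i)\<^sup>2 * t / 2 - of_int i * u)) =
      (of_int (i + 1) / 2 - (of_int (i + 1))\<^sup>2 * t / 2 - of_int (i + 1) * u)"
    by (simp add: field_simps power2_eq_square)
  finally show ?case .
next
  case (step2 i)
  have "e2pi (1/2 + (- (u + of_int (i - 1) * t) - t / 2)) * kphi (u + of_int (i - 1) * t) t = kphi (u + of_int i * t) t"
    using kphi_add_tau[OF assms, of "u + of_int (i - 1) * t"] by (simp only: e2pi_add) (simp add: algebra_simps)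
  hence "kphi (u + of_int (i - 1) * t) t = e2pi (- (1/2 + (- (u + of_int (i - 1) * t) - t / 2))) * kphi (u + of_int i * t) t"
    by (simp only: e2pi_minus) (simp add: field_simps)
  also have "\<dots> = e2pi (- (1/2 + (- (u + of_int (i - 1) * t) - t / 2)) + (of_int i / 2 - (of_int i)\<^sup>2 * t / 2 - of_int i * u)) * kphi u t"
    by (simp only: step2 e2pi_add mult.assoc)
  also have "- (1/2 + (- (u + of_int (i - 1) * t) - t / 2)) + (of_int i / 2 - (of_int i)\<^sup>2 * t / 2 - of_int i * u) =
      (of_int (i - 1) / 2 - (of_int (i - 1))\<^sup>2 * t / 2 - of_int (i - 1) * u)"
    by (simp add: field_simps power2_eq_square)
  finally show ?case .
qed auto

lemma kphi_add_lattice: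
  assumes "Im t > 0"
  shows "kphi (u + of_int m * t + of_int n) t =
           e2pi (of_int (m + n) / 2 - (of_int m)\<^sup>2 * t / 2 - of_int m * u) * kphi u t"
proof -
  have "kphi (u + of_int m * t + of_int n) t = 
      e2pi (of_int n / 2 + (of_int m / 2 - (of_int m)\<^sup>2 * t / 2 - of_int m * u)) * kphi u t"
    by (simp only: kphi_add_int kphi_add_int_tau[OF assms] e2pi_add mult.assoc)
  thus ?thesis by (simp add: add_divide_distrib algebra_simps)
qed

lemma kphi_0 [simp]: "kphi 0 t = 0"
  by (simp add: kphi_def)

text \<open>The prefactor vanishes exactly at the integers, and each of the two products at the
  lattice points on one side, \<open>m < 0\<close> or \<open>m > 0\<close>.\<close>

lemma kphi_eq_0_iff:
  assumes "Im t > 0"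
  shows "kphi u t = 0 \<longleftrightarrow> (\<exists>m n :: int. u = of_int m * t + of_int n)"
proof
  assume "\<exists>m n :: int. u = of_int m * t + of_int n"
  then obtain m n :: int where "u = 0 + of_int m * t + of_int n" by auto
  thus "kphi u t = 0" by (simp only: kphi_add_lattice[OF assms]) simp
next
  assume "kphi u t = 0"
  note less = norm_e2pi_less_1[OF assms]
  from \<open>kphi u t = 0\<close> consider "e2pi (u / 2) = e2pi (- u / 2)" | "qprod (e2pi u) (e2pi t) = 0" | "qprod (e2pi (- u)) (e2pi t) = 0"
    using qprod_one_nonzero[OF less] by (auto simp: kphi_def)
  thus "\<exists>m n :: int. u = of_int m * t + of_int n"
  proof cases
    case 1
    hence "e2pi (u / 2 - (- u / 2)) = 1"
      by (simp only: e2pi_diff) simp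
    then obtain n where "u = of_int n"
      by (auto simp: e2pi_eq_1_iff)
    thus ?thesis by (intro exI[of _ 0] exI[of _ n]) auto
  next
    case 2
    then obtain k where "e2pi u * e2pi t ^ Suc k = 1"
      using qprod_eq_0_iff[OF less] by auto
    hence "e2pi (u + of_nat (Suc k) * t) = 1"
      by (simp only: e2pi_add e2pi_power)
    then obtain n where "u + of_nat (Suc k) * t = of_int n"
      by (auto simp: e2pi_eq_1_iff)
    hence "u = of_int (- int (Suc k)) * t + of_int n"
      by (simp add: algebra_simps)
    thus ?thesis by blast
  next
    case 3
    then obtain k where "e2pi (- u) * e2pi t ^ Suc k = 1"
      using qprod_eq_0_iff[OF less] by auto
    hence "e2pi (- u + of_nat (Suc k) * t) = 1"
      by (simp only: e2pi_add e2pi_power)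
    then obtain n where "- u + of_nat (Suc k) * t = of_int n"
      by (auto simp: e2pi_eq_1_iff)
    hence "u = of_int (int (Suc k)) * t + of_int (- n)"
      by (simp add: algebra_simps)
    thus ?thesis by blast
  qed
qed

lemma holomorphic_on_kphi [holomorphic_intros]:
  assumes "f holomorphic_on UNIV" "Im t > 0"
  shows "(\<lambda>u. kphi (f u) t) holomorphic_on UNIV"
  unfolding kphi_def using qprod_one_nonzero[OF norm_e2pi_less_1[OF assms(2)]]
  by (intro holomorphic_intros assms) (auto simp: norm_e2pi_less_1 assms)

text \<open>The prefactor vanishes at 0 and the remaining factor \<open>B\<close> is 1 there, so the
  derivative of \<open>B\<close> drops out of the product rule.\<close>

lemma DERIV_kphi_0:
  assumes "Im t > 0"
  shows "((\<lambda>u. kphi u t) has_field_derivative (2 * of_real pi * \<i>)) (at 0)"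
proof -
  define B where "B = (\<lambda>u. qprod (e2pi u) (e2pi t) * qprod (e2pi (- u)) (e2pi t) / (qprod 1 (e2pi t))\<^sup>2)"
  have B0: "B 0 = 1"
    using qprod_one_nonzero[OF norm_e2pi_less_1[OF assms]] by (simp add: B_def power2_eq_square)
  have "B holomorphic_on UNIV"
    unfolding B_def using qprod_one_nonzero[OF norm_e2pi_less_1[OF assms]]
    by (intro holomorphic_intros) (auto simp: norm_e2pi_less_1 assms)
  then obtain B' where B': "(B has_field_derivative B') (at 0)"
    using holomorphic_on_imp_differentiable_at[of B UNIV 0] unfolding field_differentiable_def by auto
  have A': "((\<lambda>u. e2pi (u / 2) - e2pi (- u / 2)) has_field_derivative 2 * of_real pi * \<i>) (at 0)"
    unfolding e2pi_def by (auto intro!: derivative_eq_intros)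
  have "((\<lambda>u. (e2pi (u / 2) - e2pi (- u / 2)) * B u) has_field_derivative 2 * of_real pi * \<i>) (at 0)"
    using DERIV_mult[OF A' B'] by (simp add: B0)
  thus ?thesis by (simp add: kphi_def B_def mult.assoc)
qed

section \<open>Uniqueness of the theta quotient by Liouville's theorem\<close>

text \<open>The type of values is arbitrary so that the lemma also applies to predicates such as
  \<open>N v = 0\<close>.\<close>

lemma periodic_of_int:
  fixes g :: "complex \<Rightarrow> 'a"
  assumes "\<And>u. g (u + w) = g u"
  shows "g (u + of_int n * w) = g u"
proof (induction n rule: int_induct[where k = 0])
  case (step1 i)
  thus ?case using assms[of "u + of_int i * w"] by (simp add: algebra_simps)
next
  case (step2 i)
  thus ?case using assms[of "u + of_int (i - 1) * w"] by (simp add: algebra_simps)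
qed auto

lemma doubly_periodic_entire_constant:
  assumes hol: "g holomorphic_on UNIV" and "Im t > 0"
    and per1: "\<And>u. g (u + 1) = g u" and pert: "\<And>u. g (u + t) = g u"
  shows "g u = g v"
proof -
  define P where "P = (\<lambda>(x, y). of_real x * t + of_real y) ` ({0..1::real} \<times> {0..1::real})"
  have "compact P"
    unfolding P_def
    by (intro compact_continuous_image compact_Times) (auto intro!: continuous_intros simp: case_prod_unfold)
  moreover have "continuous_on P g"
    using hol holomorphic_on_imp_continuous_on continuous_on_subset by blast
  ultimately have "bounded (g ` P)"
    by (intro compact_imp_bounded compact_continuous_image)
  moreover have "range g \<subseteq> g ` P"
  proof safe
    fix u
    \<comment> \<open>The coordinates of \<open>u\<close> in the real basis \<open>t\<close>, 1;
      dropping their integer parts moves \<open>u\<close> into the compact parallelogram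
      \<open>P\<close>.\<close>
    define x where "x = Im u / Im t"
    define y where "y = Re u - x * Re t"
    have u: "u = of_real x * t + of_real y"
      using \<open>Im t > 0\<close> by (simp add: complex_eq_iff x_def y_def)
    have "of_real x = of_real (frac x) + (of_int \<lfloor>x\<rfloor> :: complex)" "of_real y = of_real (frac y) + (of_int \<lfloor>y\<rfloor> :: complex)"
      by (simp_all add: frac_def)
    hence "u = of_real (frac x) * t + of_real (frac y) + of_int \<lfloor>x\<rfloor> * t + of_int \<lfloor>y\<rfloor> * 1"
      unfolding u by (simp add: algebra_simps)
    hence "g u = g (of_real (frac x) * t + of_real (frac y))"
      by (simp only: periodic_of_int[of g, OF per1] periodic_of_int[of g, OF pert])
    moreover have "of_real (frac x) * t + of_real (frac y) \<in> P"
      unfolding P_def using frac_ge_0 frac_lt_1 less_imp_le by (force intro!: image_eqI[of _ _ "(frac x, frac y)"])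
    ultimately show "g u \<in> g ` P" by auto
  qed
  ultimately have "bounded (range g)" by (rule bounded_subset)
  with hol have "g constant_on UNIV" by (rule Liouville_theorem)
  thus ?thesis by (auto simp: constant_on_def)
qed

text \<open>The quotient of \<open>N\<close> by \<open>kphi\<close> is doubly periodic, and it is entire because the only zeros of
  \<open>kphi\<close> are the lattice points, all of which are translates of the removable singularity at 0.\<close>

lemma kphi_unique:
  assumes N: "N holomorphic_on UNIV" "(N has_field_derivative 2 * of_real pi * \<i>) (at 0)" "N 0 = 0"
    and t: "Im t > 0"
    and N1: "\<And>u. N (u + 1) = - N u" and Nt: "\<And>u. N (u + t) = - e2pi (- u - t / 2) * N u"
  shows "N u = kphi u t"
proof -
  \<comment> \<open>The default 1 is the limit of the quotient at 0, where \<open>N\<close> and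
    \<open>kphi\<close> have the same derivative; by periodicity it is right at every lattice
    point.\<close>
  define g where "g = (\<lambda>u. if kphi u t = 0 then 1 else N u / kphi u t)"
  have g1: "g (u + 1) = g u" for u
    by (simp add: g_def kphi_add_1 N1)
  have gt: "g (u + t) = g u" for u
    by (simp add: g_def kphi_add_tau[OF t] Nt)
  have cont: "isCont (\<lambda>u. kphi u t) u" for u
    using holomorphic_on_imp_continuous_on[OF holomorphic_on_kphi[OF holomorphic_on_ident t]]
    by (simp add: continuous_on_eq_continuous_at)
  have hol_kphi: "(\<lambda>u. kphi u t) holomorphic_on A" for A
    using holomorphic_on_kphi[OF holomorphic_on_ident t] holomorphic_on_subset by blast
  have lim1: "((\<lambda>u. kphi u t / u) \<longlongrightarrow> 2 * of_real pi * \<i>) (at 0)"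
    using DERIV_kphi_0[OF t] by (simp add: has_field_derivative_iff)
  have lim2: "((\<lambda>u. N u / u) \<longlongrightarrow> 2 * of_real pi * \<i>) (at 0)"
    using N by (simp add: has_field_derivative_iff)
  have "eventually (\<lambda>u. kphi u t / u \<noteq> 0) (at 0)"
    by (rule tendsto_imp_eventually_ne[OF lim1]) auto
  hence "eventually (\<lambda>u. kphi u t \<noteq> 0) (at 0)"
    by eventually_elim auto
  then obtain r where r: "r > 0" "\<And>u. u \<noteq> 0 \<Longrightarrow> u \<in> ball 0 r \<Longrightarrow> kphi u t \<noteq> 0"
    by (auto simp: eventually_at dist_commute)
  have lim: "(\<lambda>u. N u / kphi u t) \<midarrow>0\<rightarrow> 1"
  proof (rule Lim_transform_eventually)
    show "((\<lambda>u. (N u / u) / (kphi u t / u)) \<longlongrightarrow> 1) (at 0)"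
      using tendsto_divide[OF lim2 lim1] by simp
    show "\<forall>\<^sub>F u in at 0. (N u / u) / (kphi u t / u) = N u / kphi u t"
      by (auto simp: eventually_at_filter)
  qed
  have "(\<lambda>u. if u = 0 then 1 else N u / kphi u t) holomorphic_on ball 0 r"
    by (rule removable_singularity[OF _ _ lim])
       (use r in \<open>auto intro!: holomorphic_on_divide hol_kphi holomorphic_on_subset[OF N(1)]\<close>)
  hence "g holomorphic_on ball 0 r"
    by (rule holomorphic_transform) (auto simp: g_def r)
  hence diff0: "g field_differentiable at 0"
    using r by (intro holomorphic_on_imp_differentiable_at) auto
  have "g field_differentiable at u" for u
  proof (cases "kphi u t = 0")
    case True
    then obtain m n :: int where u: "u = of_int m * t + of_int n"
      using kphi_eq_0_iff[OF t] by auto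
    have shift: "g v = g (v - u)" for v
      using periodic_of_int[of g, OF g1, of "v - u + of_int m * t" n] periodic_of_int[of g, OF gt, of "v - u" m]
      by (simp add: u)
    have "(\<lambda>v. v - u) field_differentiable at u"
      by (intro field_differentiable_diff field_differentiable_ident field_differentiable_const)
    hence "(\<lambda>v. g (v - u)) field_differentiable at u"
      using field_differentiable_compose[of "\<lambda>v. v - u" u g] diff0 by (simp add: o_def)
    thus ?thesis by (subst shift[abs_def])
  next
    case False
    have "eventually (\<lambda>v. kphi v t \<noteq> 0) (nhds u)"
      using cont[of u, unfolded isCont_def tendsto_at_iff_tendsto_nhds[of "\<lambda>u. kphi u t"]] False
      by (rule tendsto_imp_eventually_ne)
    hence ev: "eventually (\<lambda>v. g v = N v / kphi v t) (nhds u)"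
      by eventually_elim (auto simp: g_def)
    have "(\<lambda>v. N v / kphi v t) field_differentiable at u"
      using False holomorphic_on_imp_differentiable_at[OF N(1)] holomorphic_on_imp_differentiable_at[OF hol_kphi[of UNIV]]
      by (intro field_differentiable_divide) auto
    thus ?thesis
      using DERIV_cong_ev[OF refl ev refl] by (simp add: field_differentiable_def)
  qed
  hence "g holomorphic_on UNIV"
    by (auto simp: holomorphic_on_def)
  from doubly_periodic_entire_constant[OF this t g1 gt] have "g u = g 0" .
  hence g: "g u = 1" by (simp add: g_def)
  show ?thesis
  proof (cases "kphi u t = 0")
    case False
    thus ?thesis using g by (simp add: g_def split: if_splits)
  next
    case True
    then obtain m n :: int where u: "u = of_int m * t + of_int n"
      using kphi_eq_0_iff[OF t] by auto
    \<comment> \<open>At a zero of \<open>kphi\<close> the value of \<open>g\<close> says nothing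
      about \<open>N\<close>. But the zero set of \<open>N\<close> contains 0 and is invariant under
      the lattice.\<close>
    have "N (v + 1) = 0 \<longleftrightarrow> N v = 0" "N (v + t) = 0 \<longleftrightarrow> N v = 0" for v
      by (simp_all add: N1 Nt)
    hence "N (0 + of_int m * t + of_int n * 1) = 0 \<longleftrightarrow> N 0 = 0"
      using periodic_of_int[of "\<lambda>v. N v = 0" 1 "0 + of_int m * t" n] periodic_of_int[of "\<lambda>v. N v = 0" t 0 m] by simp
    thus ?thesis using True N(3) by (simp add: u)
  qed
qed

section \<open>Modular transformation of the theta quotient\<close>

lemma Im_moebius:
  fixes a b c d :: int
  assumes "a * d - b * c = 1" "Im t > 0"
  shows "Im ((of_int a * t + of_int b) / (of_int c * t + of_int d)) = Im t / (cmod (of_int c * t + of_int d))\<^sup>2"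
proof -
  have "of_int a * of_int d - of_int b * of_int c = (1 :: real)"
    using assms(1) by (metis of_int_1 of_int_diff of_int_mult)
  hence "(of_int a * Im t * (of_int c * Re t + of_int d) - (of_int a * Re t + of_int b) * (of_int c * Im t)) = Im t"
    by algebra
  thus ?thesis
    by (simp add: Im_divide cmod_power2)
qed

lemma moebius_denom_nonzero:
  fixes a b c d :: int
  assumes "a * d - b * c = 1" "Im t > 0"
  shows "of_int c * t + of_int d \<noteq> 0"
proof
  assume "of_int c * t + of_int d = 0"
  hence "of_int c * Im t = 0" "of_int c * Re t + of_int d = 0"
    by (simp_all add: complex_eq_iff)
  thus False using assms by (auto simp: )
qed

lemma Im_moebius_pos:
  fixes a b c d :: int
  assumes "a * d - b * c = 1" "Im t > 0"
  shows "Im ((of_int a * t + of_int b) / (of_int c * t + of_int d)) > 0"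
  unfolding Im_moebius[OF assms] using moebius_denom_nonzero[OF assms] assms by simp

text \<open>Multiplication by \<open>J\<close> maps the lattice spanned by \<open>t'\<close> and 1
  onto the one spanned by \<open>t\<close> and 1. Hence the left side, corrected by a Gaussian
  factor, satisfies the conditions of \<open>kphi_unique\<close> for \<open>t\<close>.\<close>

lemma kphi_moebius:
  fixes a b c d :: int
  assumes det: "a * d - b * c = 1" and t: "Im t > 0"
  defines "J \<equiv> of_int c * t + of_int d"
  shows "kphi (u / J) ((of_int a * t + of_int b) / J) * J = e2pi (of_int c * u\<^sup>2 / (2 * J)) * kphi u t"
proof -
  define t' where "t' = (of_int a * t + of_int b) / J"
  define N where "N = (\<lambda>u. kphi (u / J) t' * J * e2pi (- (of_int c * u\<^sup>2 / (2 * J))))"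
  have J: "J \<noteq> 0" and t': "Im t' > 0"
    unfolding J_def t'_def using moebius_denom_nonzero[OF det t] Im_moebius_pos[OF det t] by simp_all
  have Jt': "J * t' = of_int a * t + of_int b"
    using J by (simp add: t'_def)
  have det': "of_int a * of_int d - of_int b * of_int c = (1 :: complex)"
    using det by (metis of_int_1 of_int_diff of_int_mult)
  \<comment> \<open>The generators 1 and \<open>t\<close>, divided by \<open>J\<close>, get their
    coordinates in the lattice of \<open>t'\<close> from the inverse matrix.\<close>
  have J1: "1 / J = of_int a - of_int c * t'"
  proof -
    have "1 = J * (of_int a - of_int c * t')"
      using det' Jt' unfolding J_def by algebra
    thus ?thesis using J by (simp add: field_simps)
  qed
  have Jt: "t / J = of_int d * t' - of_int b"
  proof -
    have "t = J * (of_int d * t' - of_int b)"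
      using det' Jt' unfolding J_def by algebra
    thus ?thesis using J by (simp add: field_simps)
  qed
  \<comment> \<open>Modulo 2 neither \<open>a\<close>, \<open>c\<close> nor \<open>b\<close>,
    \<open>d\<close> are both even. This gives both multipliers the sign -1.\<close>
  have "odd (a * d - b * c)"
    by (simp add: det)
  hence oddcd: "odd (a - c - a * c)" "odd (d - b - b * d)"
    by auto
  have "N u = kphi u t"
  proof (rule kphi_unique[OF _ _ _ t])
    show "N holomorphic_on UNIV"
      unfolding N_def using J by (intro holomorphic_intros t') auto
    show "N 0 = 0" by (simp add: N_def)
    have "((\<lambda>u. u / J) has_field_derivative 1 / J) (at 0)"
      by (rule DERIV_cdivide[OF DERIV_ident])
    moreover have "((\<lambda>u. kphi u t') has_field_derivative 2 * of_real pi * \<i>) (at (0 / J))"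
      using DERIV_kphi_0[OF t'] by simp
    ultimately have d1: "((\<lambda>u. kphi (u / J) t') has_field_derivative 2 * of_real pi * \<i> * (1 / J)) (at 0)"
      by (rule DERIV_chain2[rotated])
    have d2: "((\<lambda>u. J * e2pi (- (of_int c * u\<^sup>2 / (2 * J)))) has_field_derivative 0) (at 0)"
      unfolding e2pi_def using J by (auto intro!: derivative_eq_intros)
    show "(N has_field_derivative 2 * of_real pi * \<i>) (at 0)"
      using DERIV_mult[OF d1 d2] J by (simp add: N_def mult.assoc)
    show "N (u + 1) = - N u" for u
    proof -
      have "(u + 1) / J = u / J + of_int (- c) * t' + of_int a"
        using J1 by (simp add: add_divide_distrib)
      hence "N (u + 1) = e2pi (of_int (- c + a) / 2 - (of_int (- c))\<^sup>2 * t' / 2 - of_int (- c) * (u / J)) * kphi (u / J) t' * J *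
                 e2pi (- (of_int c * (u + 1)\<^sup>2 / (2 * J)))"
        by (simp only: N_def kphi_add_lattice[OF t'])
      also have "\<dots> = e2pi (of_int (- c + a) / 2 - (of_int (- c))\<^sup>2 * t' / 2 - of_int (- c) * (u / J) + - (of_int c * (u + 1)\<^sup>2 / (2 * J))) * kphi (u / J) t' * J"
        by (simp only: e2pi_add mult_ac)
      also have "of_int (- c + a) / 2 - (of_int (- c))\<^sup>2 * t' / 2 - of_int (- c) * (u / J) + - (of_int c * (u + 1)\<^sup>2 / (2 * J)) =
           of_int (a - c) / 2 - (of_int c)\<^sup>2 * t' / 2 - of_int c * (1 / J) / 2 - of_int c * u\<^sup>2 / (2 * J)"
        using J by (simp add: field_simps power2_eq_square)
      \<comment> \<open>Substituting \<open>1 / J = a - c t'\<close> cancels the terms in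
        \<open>t'\<close>.\<close>
      also have "\<dots> = of_int (a - c - a * c) / 2 + - (of_int c * u\<^sup>2 / (2 * J))"
        unfolding J1 by (simp add: field_simps power2_eq_square)
      also have "e2pi \<dots> * kphi (u / J) t' * J = - N u"
        by (simp only: e2pi_add e2pi_half_int_odd[OF oddcd(1)] N_def) (simp add: mult_ac)
      finally show ?thesis .
    qed
    show "N (u + t) = - e2pi (- u - t / 2) * N u" for u
    proof -
      have "(u + t) / J = u / J + of_int d * t' + of_int (- b)"
        using Jt by (simp add: add_divide_distrib)
      hence "N (u + t) = e2pi (of_int (d + - b) / 2 - (of_int d)\<^sup>2 * t' / 2 - of_int d * (u / J)) * kphi (u / J) t' * J *
                 e2pi (- (of_int c * (u + t)\<^sup>2 / (2 * J)))"
        by (simp only: N_def kphi_add_lattice[OF t'])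
      also have "\<dots> = e2pi (of_int (d + - b) / 2 - (of_int d)\<^sup>2 * t' / 2 - of_int d * (u / J) + - (of_int c * (u + t)\<^sup>2 / (2 * J))) * kphi (u / J) t' * J"
        by (simp only: e2pi_add mult_ac)
      also have "of_int (d + - b) / 2 - (of_int d)\<^sup>2 * t' / 2 - of_int d * (u / J) + - (of_int c * (u + t)\<^sup>2 / (2 * J)) =
           of_int (d - b) / 2 - (of_int d)\<^sup>2 * t' / 2 - u * ((of_int d + of_int c * t) / J) - of_int c * t * (t / J) / 2 - of_int c * u\<^sup>2 / (2 * J)"
        using J by (simp add: field_simps power2_eq_square)
      also have "(of_int d + of_int c * t) / J = 1"
        using J by (simp add: J_def add.commute)
      also have "of_int (d - b) / 2 - (of_int d)\<^sup>2 * t' / 2 - u * 1 - of_int c * t * (t / J) / 2 - of_int c * u\<^sup>2 / (2 * J)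
          = of_int (d - b - b * d) / 2 + ((- u - t / 2) + - (of_int c * u\<^sup>2 / (2 * J)))"
      proof -
        have "(of_int d)\<^sup>2 * t' + of_int c * t * (of_int d * t' - of_int b) = of_int b * of_int d + t"
          using Jt' det' unfolding J_def by algebra
        hence "(of_int d)\<^sup>2 * t' / 2 + of_int c * t * (t / J) / 2 = (of_int b * of_int d + t) / 2"
          unfolding Jt add_divide_distrib [symmetric] by simp
        thus ?thesis by (simp add: diff_divide_distrib add_divide_distrib algebra_simps)
      qed
      also have "e2pi \<dots> * kphi (u / J) t' * J = - e2pi (- u - t / 2) * N u"
        by (simp only: e2pi_add e2pi_half_int_odd[OF oddcd(2)] N_def) (simp add: mult_ac)
      finally show ?thesis .
    qed
  qed
  thus ?thesis
    by (simp add: N_def t'_def e2pi_minus field_simps)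
qed

section \<open>Klein forms\<close>

text \<open>The exponential prefactor is chosen to absorb the Gaussian factor in
  \<open>kphi_moebius\<close>.\<close>

definition klein :: "complex \<Rightarrow> complex \<Rightarrow> complex \<Rightarrow> complex" where
  "klein x y t = e2pi (x * (x * t + y) / 2) * kphi (x * t + y) t"

text \<open>The row vector \<open>(x, y)\<close> is multiplied by the matrix. The exponentials
  combine because \<open>x + c u = x' J\<close>, where \<open>u = x' t + y'\<close>.\<close>

lemma klein_moebius:
  fixes a b c d :: int
  assumes det: "a * d - b * c = 1" and t: "Im t > 0"
  shows "klein x y ((of_int a * t + of_int b) / (of_int c * t + of_int d)) =
           klein (x * of_int a + y * of_int c) (x * of_int b + y * of_int d) t / (of_int c * t + of_int d)"
proof -
  define J where "J = of_int c * t + of_int d"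
  define t' where "t' = (of_int a * t + of_int b) / J"
  define x' where "x' = x * of_int a + y * of_int c"
  define y' where "y' = x * of_int b + y * of_int d"
  define u where "u = x' * t + y'"
  have J: "J \<noteq> 0"
    unfolding J_def using moebius_denom_nonzero[OF det t] by simp
  have det': "of_int a * of_int d - of_int b * of_int c = (1 :: complex)"
    using det by (metis of_int_1 of_int_diff of_int_mult)
  have u: "x * t' + y = u / J"
    using J by (simp add: t'_def field_simps u_def x'_def y'_def) (simp add: J_def algebra_simps)
  have "kphi (u / J) t' * J = e2pi (of_int c * u\<^sup>2 / (2 * J)) * kphi u t"
    unfolding t'_def J_def by (rule kphi_moebius[OF det t])
  hence "klein x y t' = e2pi (x * (u / J) / 2) * (e2pi (of_int c * u\<^sup>2 / (2 * J)) * kphi u t) / J"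
    using J unfolding klein_def u by (metis nonzero_mult_div_cancel_right times_divide_eq_right)
  also have "\<dots> = e2pi (x * (u / J) / 2 + of_int c * u\<^sup>2 / (2 * J)) * kphi u t / J"
    by (simp add: e2pi_add)
  also have "x * (u / J) / 2 + of_int c * u\<^sup>2 / (2 * J) = (x + of_int c * u) / J * u / 2"
    using J by (simp add: field_simps power2_eq_square)
  also have "(x + of_int c * u) / J = x'"
  proof -
    have "x + of_int c * u = x' * J"
      using det' unfolding u_def x'_def y'_def J_def by algebra
    thus ?thesis using J by simp
  qed
  finally show ?thesis
    by (simp add: klein_def u_def x'_def y'_def t'_def J_def)
qed

text \<open>The \<open>t\<close>-dependent parts of the multiplier of \<open>kphi\<close> cancel
  against the prefactor; for rational \<open>x\<close> and \<open>y\<close> a root of unity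
  remains.\<close>

lemma klein_add_int:
  fixes m n :: int
  assumes "Im t > 0"
  shows "klein (x + of_int m) (y + of_int n) t =
           e2pi ((of_int (m + n + m * n) + x * of_int n - y * of_int m) / 2) * klein x y t"
proof -
  have "(x + of_int m) * t + (y + of_int n) = x * t + y + of_int m * t + of_int n"
    by (simp add: algebra_simps)
  hence "klein (x + of_int m) (y + of_int n) t =
      e2pi ((x + of_int m) * (x * t + y + of_int m * t + of_int n) / 2) *
      (e2pi (of_int (m + n) / 2 - (of_int m)\<^sup>2 * t / 2 - of_int m * (x * t + y)) * kphi (x * t + y) t)"
    unfolding klein_def by (simp only: kphi_add_lattice[OF assms])
  also have "\<dots> = e2pi ((x + of_int m) * (x * t + y + of_int m * t + of_int n) / 2 + 
      (of_int (m + n) / 2 - (of_int m)\<^sup>2 * t / 2 - of_int m * (x * t + y))) * kphi (x * t + y) t"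
    by (simp only: e2pi_add mult.assoc)
  also have "(x + of_int m) * (x * t + y + of_int m * t + of_int n) / 2 + 
      (of_int (m + n) / 2 - (of_int m)\<^sup>2 * t / 2 - of_int m * (x * t + y)) =
      (of_int (m + n + m * n) + x * of_int n - y * of_int m) / 2 + x * (x * t + y) / 2"
    by (simp add: field_simps power2_eq_square)
  finally show ?thesis
    by (simp only: e2pi_add klein_def mult.assoc)
qed

section \<open>The eta function as a product of Klein forms\<close>

lemma dedekind_eta_altdef: "dedekind_eta t = e2pi (t / 24) * qprod 1 (e2pi t)"
  by (simp add: dedekind_eta_def e2pi_def qprod_def)

lemma dedekind_eta_nonzero: "Im t > 0 \<Longrightarrow> dedekind_eta t \<noteq> 0"
  by (simp add: dedekind_eta_altdef qprod_one_nonzero norm_e2pi_less_1)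

lemma e2pi_quarter: "e2pi (1 / 4) = \<i>"
proof -
  have "e2pi (1 / 4) = cis (pi / 2)"
    by (simp add: e2pi_def cis_conv_exp mult_ac)
  thus ?thesis by simp
qed

text \<open>Each factor is the square of an infinite product, up to elementary factors and
  \<open>P\<^sup>2\<close> in the denominator. The three infinite products multiply to 1, which
  leaves \<open>w * P ^ 6\<close>, the sixth power of \<open>\<eta>\<close>.\<close>

lemma klein_half_product:
  assumes t: "Im t > 0"
  shows "klein 0 (1 / 2) t * klein (1 / 2) 0 t * klein (1 / 2) (1 / 2) t = 2 * e2pi (1 / 8) / dedekind_eta t ^ 6"
proof -
  \<comment> \<open>Successive squares of \<open>v\<close> give \<open>e2pi\<close> at
    \<open>t / 4\<close>, \<open>t / 2\<close> and \<open>t\<close>, so all exponentials are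
    monomials.\<close>
  define v where "v = e2pi (t / 8)"
  define w where "w = v\<^sup>2"
  define s where "s = w\<^sup>2"
  define q where "q = s\<^sup>2"
  have nz: "v \<noteq> 0" "w \<noteq> 0" "s \<noteq> 0" "q \<noteq> 0" by (auto simp: v_def w_def s_def q_def)
  have w: "e2pi (t / 4) = w" and s: "e2pi (t / 2) = s" and q: "e2pi t = q"
    by (simp_all add: v_def w_def s_def q_def e2pi_power)
  have less: "norm q < 1" using norm_e2pi_less_1[OF t] q by simp
  define P where "P = qprod 1 q"
  have P: "P \<noteq> 0" unfolding P_def by (rule qprod_one_nonzero[OF less])
  have r1: "qprod (1 / s) q = (1 - s) * qprod s q"
    using qprod_rec[OF less, of "1 / s"] nz by (simp add: q_def power2_eq_square)
  have r2: "qprod (- 1 / s) q = (1 + s) * qprod (- s) q"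
    using qprod_rec[OF less, of "- 1 / s"] nz by (simp add: q_def power2_eq_square)
  have K1: "klein 0 (1 / 2) t = 2 * \<i> * (qprod (-1) q)\<^sup>2 / P\<^sup>2"
  proof -
    have "e2pi (- (1 / 4)) = - \<i>" "e2pi (- (1 / 2)) = -1"
      by (simp_all add: e2pi_minus e2pi_quarter)
    thus ?thesis
      by (simp add: klein_def kphi_def e2pi_quarter q P_def power2_eq_square)
  qed
  have K2: "klein (1 / 2) 0 t = - (qprod (1 / s) q)\<^sup>2 / (v * P\<^sup>2)"
  proof -
    have "e2pi (- (t / 4)) = 1 / w" "e2pi (- (t / 2)) = 1 / s"
      by (simp_all add: e2pi_minus w s inverse_eq_divide)
    hence "klein (1 / 2) 0 t = v * ((w - 1 / w) * qprod s q * qprod (1 / s) q / P\<^sup>2)"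
      by (simp add: klein_def kphi_def w s q P_def v_def)
    also have "w - 1 / w = - (1 - s) / w"
      using nz by (simp add: s_def field_simps power2_eq_square)
    also have "- (1 - s) / w * qprod s q = - qprod (1 / s) q / w"
      unfolding r1 by (simp only: minus_mult_left times_divide_eq_left)
    finally show ?thesis
      using nz by (simp add: w_def power2_eq_square)
  qed
  have K3: "klein (1 / 2) (1 / 2) t = e2pi (1 / 8) * \<i> * (qprod (- 1 / s) q)\<^sup>2 / (v * P\<^sup>2)"
  proof -
    have e: "e2pi (t / 4 + 1 / 4) = \<i> * w" "e2pi (t / 2 + 1 / 2) = - s" "e2pi (t / 8 + 1 / 8) = v * e2pi (1 / 8)"
      unfolding e2pi_add by (simp_all add: e2pi_quarter w s v_def)
    have e': "e2pi (- (t / 4 + 1 / 4)) = 1 / (\<i> * w)" "e2pi (- (t / 2 + 1 / 2)) = - 1 / s"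
      unfolding e2pi_minus e by (simp_all add: inverse_eq_divide)
    have "e2pi ((- (t / 2) - 1 / 2) / 2) = e2pi (- (t / 4) - 1 / 4)"
      by (simp add: diff_divide_distrib)
    hence "klein (1 / 2) (1 / 2) t = e2pi (t / 8 + 1 / 8) * ((e2pi (t / 4 + 1 / 4) - e2pi (- (t / 4 + 1 / 4))) * 
        qprod (e2pi (t / 2 + 1 / 2)) q * qprod (e2pi (- (t / 2 + 1 / 2))) q / P\<^sup>2)"
      by (simp add: klein_def kphi_def q P_def add_divide_distrib)
    also have "\<dots> = v * e2pi (1 / 8) * ((\<i> * w - 1 / (\<i> * w)) * qprod (- s) q * qprod (- 1 / s) q / P\<^sup>2)"
      unfolding e e' ..
    also have "\<i> * w - 1 / (\<i> * w) = \<i> * (1 + s) / w"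
      using nz by (simp add: s_def field_simps power2_eq_square)
    also have "\<i> * (1 + s) / w * qprod (- s) q = \<i> * qprod (- 1 / s) q / w"
      unfolding r2 by simp
    finally show ?thesis
      using nz by (simp add: w_def power2_eq_square)
  qed
  \<comment> \<open>Euler's identity: the product of all \<open>1 + q ^ n\<close> and of all
    \<open>1 - q ^ (2 n - 1)\<close> is 1. It is proved after multiplication by
    \<open>P\<close>.\<close>
  have "qprod (-1) q * P = qprod 1 (q\<^sup>2)"
    using qprod_mult_minus[OF less, of 1] by (simp add: P_def mult.commute)
  moreover have "qprod (1 / s) q * qprod (- 1 / s) q = qprod (1 / q) (q\<^sup>2)"
    using qprod_mult_minus[OF less, of "1 / s"] by (simp add: q_def power_divide)
  moreover have "P = qprod 1 (q\<^sup>2) * qprod (1 / q) (q\<^sup>2)"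
    using qprod_split[OF less nz(4), of 2 1] by (simp add: P_def numeral_2_eq_2)
  ultimately have "qprod (-1) q * (qprod (1 / s) q * qprod (- 1 / s) q) * P = P"
    by (metis mult.assoc mult.commute)
  hence *: "qprod (-1) q * (qprod (1 / s) q * qprod (- 1 / s) q) = 1"
    using P by simp
  have "klein 0 (1 / 2) t * klein (1 / 2) 0 t * klein (1 / 2) (1 / 2) t = 
     2 * e2pi (1 / 8) * (qprod (-1) q * (qprod (1 / s) q * qprod (- 1 / s) q))\<^sup>2 / (w * P ^ 6)"
    unfolding K1 K2 K3 using nz P by (simp add: w_def field_simps power2_eq_square power_def numeral_eq_Suc)
  also have "w * P ^ 6 = dedekind_eta t ^ 6"
    by (simp add: dedekind_eta_altdef power_mult_distrib e2pi_power q P_def w [symmetric])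
  finally show ?thesis using * by simp
qed

text \<open>At half-integral arguments the multiplier in \<open>klein_add_int\<close> is a fourth
  root of unity.\<close>

lemma klein_half_int:
  fixes m n :: int
  assumes "Im t > 0"
  shows "klein (of_int m / 2) (of_int n / 2) t ^ 4 = klein (if odd m then 1 / 2 else 0) (if odd n then 1 / 2 else 0) t ^ 4"
proof -
  define x :: complex where "x = (if odd m then 1 / 2 else 0)"
  define y :: complex where "y = (if odd n then 1 / 2 else 0)"
  define \<mu> \<nu> :: int where "\<mu> = (if odd m then 1 else 0)" and "\<nu> = (if odd n then 1 else 0)"
  define m' n' where "m' = m div 2" and "n' = n div 2"
  have xy: "x = of_int \<mu> / 2" "y = of_int \<nu> / 2"
    by (simp_all add: x_def y_def \<mu>_def \<nu>_def)
  have "m = 2 * m' + \<mu>" "n = 2 * n' + \<nu>"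
    by (auto simp: m'_def n'_def \<mu>_def \<nu>_def elim!: oddE evenE)
  hence mn: "of_int m / 2 = x + of_int m'" "of_int n / 2 = y + of_int n'"
    by (simp_all add: xy field_simps)
  have "4 * ((of_int (m' + n' + m' * n') + x * of_int n' - y * of_int m') / 2) =
           (of_int (2 * (m' + n' + m' * n') + \<mu> * n' - \<nu> * m') :: complex)"
    by (simp add: xy field_simps)
  hence "e2pi ((of_int (m' + n' + m' * n') + x * of_int n' - y * of_int m') / 2) ^ 4 = 1"
    by (simp only: e2pi_power of_nat_numeral e2pi_of_int)
  thus ?thesis
    unfolding mn klein_add_int[OF assms] power_mult_distrib by (simp add: x_def y_def)
qed

text \<open>The matrix permutes the three nonzero classes of half periods modulo the lattice. So the
  fourth power of \<open>klein_half_product\<close> only acquires the factor \<open>J ^ 12\<close>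
  in the denominator.\<close>

theorem dedekind_eta_moebius_power24:
  fixes a b c d :: int
  assumes det: "a * d - b * c = 1" and t: "Im t > 0"
  shows "dedekind_eta ((of_int a * t + of_int b) / (of_int c * t + of_int d)) ^ 24 =
           (of_int c * t + of_int d) ^ 12 * dedekind_eta t ^ 24"
proof -
  define J where "J = of_int c * t + of_int d"
  define t' where "t' = (of_int a * t + of_int b) / J"
  have J: "J \<noteq> 0" and t': "Im t' > 0"
    unfolding J_def t'_def using moebius_denom_nonzero[OF det t] Im_moebius_pos[OF det t] by simp_all
  define F where "F = (\<lambda>m n. klein (of_int m / 2) (of_int n / 2) t ^ 4)"
  have F: "F m n = F (if odd m then 1 else 0) (if odd n then 1 else 0)" for m n
    unfolding F_def by (subst klein_half_int[OF t]) auto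
  have tr: "klein x y t' = klein (x * of_int a + y * of_int c) (x * of_int b + y * of_int d) t / J" for x y
    unfolding t'_def J_def by (rule klein_moebius[OF det t])
  have "(klein 0 (1 / 2) t' * klein (1 / 2) 0 t' * klein (1 / 2) (1 / 2) t') ^ 4 =
      (F c d / J ^ 4) * (F a b / J ^ 4) * (F (a + c) (b + d) / J ^ 4)"
    unfolding tr F_def by (simp add: power_mult_distrib power_divide add_divide_distrib)
  also have "\<dots> = (F c d * F a b * F (a + c) (b + d)) / J ^ 12"
    by (simp add: power_add [symmetric])
  \<comment> \<open>Checked over the parities of the entries; those with even determinant are
    excluded.\<close>
  also have "F c d * F a b * F (a + c) (b + d) = F 0 1 * F 1 0 * F 1 1"
  proof -
    have "odd (a * d - b * c)" using det by simp
    thus ?thesis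
      unfolding F[of c d] F[of a b] F[of "a + c" "b + d"]
      by (cases "even a"; cases "even b"; cases "even c"; cases "even d") (simp_all add: mult_ac)
  qed
  also have "\<dots> = (klein 0 (1 / 2) t * klein (1 / 2) 0 t * klein (1 / 2) (1 / 2) t) ^ 4"
    by (simp add: F_def power_mult_distrib)
  finally have "16 * e2pi (1 / 8) ^ 4 / (dedekind_eta t' ^ 6) ^ 4 = 16 * e2pi (1 / 8) ^ 4 / (dedekind_eta t ^ 6) ^ 4 / J ^ 12"
    unfolding klein_half_product[OF t] klein_half_product[OF t'] power_divide power_mult_distrib by simp
  hence "dedekind_eta t' ^ 24 = J ^ 12 * dedekind_eta t ^ 24"
    using J dedekind_eta_nonzero[OF t] dedekind_eta_nonzero[OF t']
    by (simp add: power_mult [symmetric] divide_simps mult_ac)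
  thus ?thesis by (simp add: t'_def J_def)
qed

corollary norm_dedekind_eta_moebius:
  fixes a b c d :: int
  assumes det: "a * d - b * c = 1" and t: "Im t > 0"
  shows "(norm (dedekind_eta ((of_int a * t + of_int b) / (of_int c * t + of_int d))))\<^sup>2 =
           norm (of_int c * t + of_int d) * (norm (dedekind_eta t))\<^sup>2"
proof (rule power_eq_imp_eq_base)
  show "((norm (dedekind_eta ((of_int a * t + of_int b) / (of_int c * t + of_int d))))\<^sup>2) ^ 12 =
      (norm (of_int c * t + of_int d) * (norm (dedekind_eta t))\<^sup>2) ^ 12"
    using arg_cong[OF dedekind_eta_moebius_power24[OF det t], of norm]
    by (simp add: norm_mult norm_power power_mult_distrib power_mult [symmetric])
qed auto

section \<open>Klein forms at the points of order p\<close>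

lemma e2pi_sum: "finite A \<Longrightarrow> (\<Prod>x\<in>A. e2pi (f x)) = e2pi (\<Sum>x\<in>A. f x)"
  by (induction A rule: finite_induct) (auto simp: e2pi_add)

lemma sum_of_nat_upto: "(\<Sum>j=1..h. of_nat j :: complex) = of_nat h * (of_nat h + 1) / 2"
  by (induction h) (simp_all add: field_simps)

lemma sum_of_nat_squares_upto: "(\<Sum>j=1..h. (of_nat j)\<^sup>2 :: complex) = of_nat h * (of_nat h + 1) * (2 * of_nat h + 1) / 6"
  by (induction h) (simp_all add: field_simps power2_eq_square)

text \<open>Prepares \<open>qprod_split\<close>: the factors of residues \<open>j\<close> and
  \<open>p - j\<close> appear together in one Klein form.\<close>

lemma kphi_multiple:
  assumes t: "Im t > 0" and j: "j \<le> p" and "p > 0"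
  defines "q \<equiv> e2pi t"
  shows "kphi (of_nat j * t) (of_nat p * t) =
           - e2pi (- (of_nat j * t / 2)) * (qprod (1 / q ^ (p - j)) (q ^ p) * qprod (1 / q ^ j) (q ^ p)) / (qprod 1 (q ^ p))\<^sup>2"
proof -
  have q0: "q \<noteq> 0" by (simp add: q_def)
  have less: "norm (q ^ p) < 1"
    using norm_e2pi_less_1[OF t] \<open>p > 0\<close> by (simp add: q_def norm_power power_less_one_iff)
  have e: "e2pi (of_nat j * t) = q ^ j" "e2pi (- (of_nat j * t)) = 1 / q ^ j" "e2pi (of_nat p * t) = q ^ p"
    by (simp_all add: q_def e2pi_power e2pi_minus inverse_eq_divide)
  have "q ^ p / q ^ (p - j) = q ^ j"
    using j q0 by (simp add: power_diff)
  hence rec: "qprod (1 / q ^ (p - j)) (q ^ p) = (1 - q ^ j) * qprod (q ^ j) (q ^ p)"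
    using qprod_rec[OF less, of "1 / q ^ (p - j)"] by simp
  have "e2pi (of_nat j * t / 2 + of_nat j * t / 2) = q ^ j"
    using e(1) by (simp add: mult.commute)
  hence sq: "e2pi (of_nat j * t / 2) * e2pi (of_nat j * t / 2) = q ^ j"
    by (simp only: e2pi_add)
  have "e2pi (of_nat j * t / 2) - e2pi (- (of_nat j * t / 2)) = - e2pi (- (of_nat j * t / 2)) * (1 - q ^ j)"
    unfolding sq [symmetric] by (simp add: e2pi_minus field_simps)
  thus ?thesis
    unfolding kphi_def e rec by (simp add: mult_ac)
qed

text \<open>One index is taken from each pair \<open>j\<close>, \<open>p - j\<close> of nonzero
  residues modulo \<open>p = 2 h + 1\<close>.\<close>

definition klein_product :: "nat \<Rightarrow> complex \<Rightarrow> complex" where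
  "klein_product h t = (\<Prod>j=1..h. klein (of_nat j / of_nat (2 * h + 1)) 0 (of_nat (2 * h + 1) * t))"

text \<open>By \<open>qprod_split\<close> the Euler product at \<open>q\<close> is the product of
  \<open>W j\<close> over all residues modulo \<open>p\<close>. Residue 0 gives \<open>P\<close>,
  and the others pair up in the Klein forms.\<close>

lemma dedekind_eta_eq_klein_product:
  fixes h :: nat
  assumes t: "Im t > 0"
  defines "p \<equiv> 2 * h + 1"
  shows "dedekind_eta t = (-1) ^ h * klein_product h t * dedekind_eta (of_nat p * t) ^ p"
proof -
  define q where "q = e2pi t"
  define P where "P = qprod 1 (q ^ p)"
  define W where "W = (\<lambda>j. qprod (1 / q ^ j) (q ^ p))"
  have "p > 0" by (simp add: p_def)
  hence p: "p > 0" "of_nat p \<noteq> (0 :: complex)" by simp_all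
  have q0: "q \<noteq> 0" by (simp add: q_def)
  have less: "norm (q ^ p) < 1" "norm q < 1"
    using norm_e2pi_less_1[OF t] \<open>p > 0\<close> by (simp_all add: q_def norm_power power_less_one_iff)
  have P0: "P \<noteq> 0" unfolding P_def by (rule qprod_one_nonzero[OF less(1)])
  have "klein (of_nat j / of_nat p) 0 (of_nat p * t) =
      - e2pi (of_nat j * of_nat j * t / (2 * of_nat p) - of_nat j * t / 2) * (W (p - j) * W j / P\<^sup>2)" if "j \<in> {1..h}" for j
  proof -
    have "klein (of_nat j / of_nat p) 0 (of_nat p * t) = e2pi (of_nat j * of_nat j * t / (2 * of_nat p)) * kphi (of_nat j * t) (of_nat p * t)"
      using p by (simp add: klein_def mult_ac)
    also have "kphi (of_nat j * t) (of_nat p * t) = - e2pi (- (of_nat j * t / 2)) * (W (p - j) * W j) / P\<^sup>2"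
      unfolding W_def P_def q_def using that by (intro kphi_multiple t) (auto simp: p_def)
    finally show ?thesis
      by (simp add: e2pi_diff e2pi_minus inverse_eq_divide)
  qed
  hence "klein_product h t = (\<Prod>j=1..h. - e2pi (of_nat j * of_nat j * t / (2 * of_nat p) - of_nat j * t / 2) * (W (p - j) * W j / P\<^sup>2))"
    unfolding klein_product_def p_def by (intro prod.cong refl) auto
  also have "\<dots> = (-1) ^ h * (\<Prod>j=1..h. e2pi (of_nat j * of_nat j * t / (2 * of_nat p) - of_nat j * t / 2)) *
       ((\<Prod>j=1..h. W (p - j)) * (\<Prod>j=1..h. W j)) / P ^ (2 * h)"
    by (simp add: prod.distrib prod_dividef prod_uminus power_mult [symmetric])
  \<comment> \<open>The exponents add up to \<open>- h (h + 1) / 6 = (1 - p\<^sup>2) / 24\<close>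
    times \<open>t\<close>.\<close>
  also have "(\<Prod>j=1..h. e2pi (of_nat j * of_nat j * t / (2 * of_nat p) - of_nat j * t / 2)) = e2pi (t / 24 - of_nat p * of_nat p * t / 24)"
  proof -
    have "(\<Sum>j=1..h. of_nat j * of_nat j * t / (2 * of_nat p) - of_nat j * t / 2) =
        (\<Sum>j=1..h. (of_nat j)\<^sup>2) * (t / (2 * of_nat p)) - (\<Sum>j=1..h. of_nat j) * (t / 2)"
      by (simp add: sum_subtractf sum_distrib_right sum_divide_distrib power2_eq_square)
    also have "\<dots> = t / 24 - of_nat p * of_nat p * t / 24"
    proof -
      have p2: "2 * of_nat h + 1 = (of_nat p :: complex)" by (simp add: p_def)
      have "of_nat h * (of_nat h + 1) * of_nat p / 6 * (t / (2 * of_nat p)) = of_nat h * (of_nat h + 1) * t / (12 :: complex)"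
        using p by simp
      moreover have "of_nat h * (of_nat h + 1) * t / 12 - of_nat h * (of_nat h + 1) / 2 * (t / 2) = t / 24 - of_nat p * of_nat p * t / (24 :: complex)"
        unfolding p2 [symmetric] by (simp add: field_simps)
      ultimately show ?thesis
        unfolding sum_of_nat_squares_upto sum_of_nat_upto p2 by (simp only:)
    qed
    finally show ?thesis by (simp add: e2pi_sum)
  qed
  also have "(\<Prod>j=1..h. W (p - j)) * (\<Prod>j=1..h. W j) = (\<Prod>j=1..<p. W j)"
  proof -
    have "(\<Prod>j=1..h. W (p - j)) = (\<Prod>j=h+1..<p. W j)"
      by (rule prod.reindex_bij_witness[of _ "\<lambda>j. p - j" "\<lambda>j. p - j"]) (auto simp: p_def)
    moreover have "(\<Prod>j=1..<p. W j) = (\<Prod>j=1..<h+1. W j) * (\<Prod>j=h+1..<p. W j)"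
      by (rule prod.atLeastLessThan_concat [symmetric]) (auto simp: p_def)
    moreover have "{1..<h+1} = {1..h}" by auto
    ultimately show ?thesis by (metis mult.commute)
  qed
  also have "(\<Prod>j=1..<p. W j) = qprod 1 q / P"
  proof -
    have "qprod 1 q = (\<Prod>j<p. W j)"
      unfolding W_def by (rule qprod_split[OF less(2) q0 p(1)])
    also have "{..<p} = insert 0 {1..<p}" using p by auto
    also have "(\<Prod>j\<in>insert 0 {1..<p}. W j) = P * (\<Prod>j=1..<p. W j)"
      by (subst prod.insert) (auto simp: W_def P_def)
    finally show ?thesis using P0 by simp
  qed
  finally have "(-1) ^ h * klein_product h t * dedekind_eta (of_nat p * t) ^ p =
      ((-1) ^ h * (-1) ^ h) * (e2pi (t / 24 - of_nat p * of_nat p * t / 24) * e2pi (of_nat p * t / 24) ^ p) * (qprod 1 q / P / P ^ (2 * h) * P ^ p)"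
    by (simp add: dedekind_eta_altdef power_mult_distrib P_def q_def e2pi_power mult_ac)
  also have "qprod 1 q / P / P ^ (2 * h) * P ^ p = qprod 1 q"
    using P0 by (simp add: p_def)
  also have "e2pi (t / 24 - of_nat p * of_nat p * t / 24) * e2pi (of_nat p * t / 24) ^ p = e2pi (t / 24)"
    by (simp add: e2pi_power e2pi_add [symmetric] mult.assoc)
  finally show ?thesis
    by (simp add: dedekind_eta_altdef q_def power_add [symmetric] mult_2 [symmetric])
qed

section \<open>Invariance under \<open>Gamma1 p\<close>\<close>

text \<open>As 3 does not divide \<open>p\<close>, \<open>h\<close> is 0 or 2 modulo 3. This makes
  the sum of the phases in \<open>klein_product_moebius\<close> an integer.\<close>

lemma six_dvd_prime_half:
  fixes p h :: nat
  assumes "prime p" "p > 3" "p = 2 * h + 1"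
  shows "6 dvd h * (h + 1)"
proof -
  have "\<not> 3 dvd 2 * h + 1"
    using assms primes_dvd_imp_eq[of 3 p] by auto
  hence "h mod 3 = 0 \<or> h mod 3 = 2"
    by presburger
  hence "3 dvd h * (h + 1)"
    by (metis dvd_mult dvd_mult2 mod_0_imp_dvd mod_Suc Suc_eq_plus1 numeral_2_eq_2 numeral_3_eq_3)
  moreover have "2 dvd h * (h + 1)"
    by simp
  ultimately show ?thesis
    using divides_mult[of 2 "h * (h + 1)" 3] by simp
qed

text \<open>On \<open>w = p t\<close> the matrix with rows \<open>(a, p b)\<close> and
  \<open>(c, d)\<close> acts. Since \<open>a = 1 + p \<alpha>\<close>, it shifts
  \<open>(j / p, 0)\<close> by the integer vector \<open>(j \<alpha>, j b)\<close>, so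
  \<open>klein_add_int\<close> yields a root of unity for each \<open>j\<close>; their product is
  1.\<close>

lemma klein_product_moebius:
  fixes a b c d :: int and p h :: nat
  assumes p: "prime p" "p > 3" "p = 2 * h + 1" and det: "a * d - b * (int p * c) = 1" and a: "[a = 1] (mod int p)"
    and t: "Im t > 0"
  shows "klein_product h ((of_int a * t + of_int b) / (of_int (int p * c) * t + of_int d)) =
           klein_product h t / (of_int (int p * c) * t + of_int d) ^ h"
proof -
  define J where "J = of_int (int p * c) * t + of_int d"
  define w where "w = of_nat p * t"
  have w: "Im w > 0" using t p by (simp add: w_def)
  have "p \<noteq> 0" using p(2) by simp
  hence p0: "of_nat p \<noteq> (0 :: complex)" by simp
  have det': "a * d - (int p * b) * c = 1" using det by (simp add: algebra_simps)
  obtain \<alpha> where \<alpha>: "a = 1 + int p * \<alpha>"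
    using a by (metis add.commute cong_iff_lin cong_sym)
  have J': "of_int c * w + of_int d = J"
    by (simp add: J_def w_def)
  have w': "of_nat p * ((of_int a * t + of_int b) / J) = (of_int a * w + of_int (int p * b)) / (of_int c * w + of_int d)"
    unfolding J' by (simp add: w_def algebra_simps)
  have factor: "klein (of_nat j / of_nat p) 0 (of_nat p * ((of_int a * t + of_int b) / J)) =
      e2pi ((of_int (\<alpha> + b) * of_nat j + (of_int (\<alpha> * b) + of_int b / of_nat p) * (of_nat j)\<^sup>2) / 2) * (klein (of_nat j / of_nat p) 0 w / J)" for j
  proof -
    have "klein (of_nat j / of_nat p) 0 (of_nat p * ((of_int a * t + of_int b) / J)) =
       klein (of_nat j / of_nat p * of_int a) (of_nat j / of_nat p * of_int (int p * b)) w / J"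
      unfolding w' by (subst klein_moebius[OF det' w]) (simp add: J')
    also have "of_nat j / of_nat p * of_int a = of_nat j / of_nat p + (of_int (int j * \<alpha>) :: complex)"
      using p0 by (simp add: \<alpha> field_simps)
    also have "of_nat j / of_nat p * of_int (int p * b) = 0 + (of_int (int j * b) :: complex)"
      using p0 by simp
    also have "klein (of_nat j / of_nat p + of_int (int j * \<alpha>)) (0 + of_int (int j * b)) w =
        e2pi ((of_int (int j * \<alpha> + int j * b + (int j * \<alpha>) * (int j * b)) + of_nat j / of_nat p * of_int (int j * b) - 0 * of_int (int j * \<alpha>)) / 2) *
        klein (of_nat j / of_nat p) 0 w"
      by (rule klein_add_int[OF w])
    also have "of_int (int j * \<alpha> + int j * b + (int j * \<alpha>) * (int j * b)) + of_nat j / of_nat p * of_int (int j * b) - 0 * of_int (int j * \<alpha>) =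
        (of_int (\<alpha> + b) * of_nat j + (of_int (\<alpha> * b) + of_int b / of_nat p) * (of_nat j)\<^sup>2 :: complex)"
      by (simp add: algebra_simps power2_eq_square)
    finally show ?thesis by simp
  qed
  obtain T where T: "h * (h + 1) = 6 * T"
    using six_dvd_prime_half[OF p] by (elim dvdE)
  have T': "of_nat h * (of_nat h + 1) = (6 * of_nat T :: complex)"
    using arg_cong[OF T, of of_nat] by (simp add: algebra_simps)
  have p2: "2 * of_nat h + 1 = (of_nat p :: complex)" by (simp add: p(3))
  have "klein_product h ((of_int a * t + of_int b) / J) =
      (\<Prod>j=1..h. e2pi ((of_int (\<alpha> + b) * of_nat j + (of_int (\<alpha> * b) + of_int b / of_nat p) * (of_nat j)\<^sup>2) / 2)) * (klein_product h t / J ^ h)"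
    unfolding klein_product_def p(3) [symmetric] factor by (simp add: prod.distrib prod_dividef w_def)
  also have "(\<Prod>j=1..h. e2pi ((of_int (\<alpha> + b) * of_nat j + (of_int (\<alpha> * b) + of_int b / of_nat p) * (of_nat j)\<^sup>2) / 2)) =
     e2pi ((of_int (\<alpha> + b) * (\<Sum>j=1..h. of_nat j) + (of_int (\<alpha> * b) + of_int b / of_nat p) * (\<Sum>j=1..h. (of_nat j)\<^sup>2)) / 2)"
    by (simp add: e2pi_sum sum_distrib_left sum.distrib sum_divide_distrib [symmetric])
  also have "of_int (\<alpha> + b) * (\<Sum>j=1..h. of_nat j) + (of_int (\<alpha> * b) + of_int b / of_nat p) * (\<Sum>j=1..h. (of_nat j)\<^sup>2) =
      (of_int (int T * (\<alpha> * (3 + b * int p) + 4 * b)) :: complex)"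
    unfolding sum_of_nat_upto sum_of_nat_squares_upto p2 T' using p0 by (simp add: field_simps)
  \<comment> \<open>If \<open>\<alpha>\<close> is odd, then \<open>a\<close> is even, so
    \<open>b\<close> is odd by the determinant and \<open>3 + b p\<close> is even.\<close>
  also have "even (int T * (\<alpha> * (3 + b * int p) + 4 * b))"
  proof -
    have "odd (int p)" using p(3) by simp
    moreover have "odd (a * d - b * (int p * c))" using det by simp
    ultimately show ?thesis by (auto simp: \<alpha>)
  qed
  hence "e2pi (of_int (int T * (\<alpha> * (3 + b * int p) + 4 * b)) / 2) = 1"
    by (elim evenE) (simp del: of_int_mult add: of_int_mult[of 2])
  finally show ?thesis by (simp add: J_def)
qed

text \<open>Substituting the Klein product for \<open>\<eta>(z)\<close> leaves a power of
  \<open>\<eta>(p z)\<close> with exponent \<open>p r + s = 24 m\<close>. The weights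
  \<open>12 m\<close> and \<open>- h r\<close> of the two parts add up to \<open>k\<close>.\<close>

theorem eta_quotient_Gamma1:
  fixes a b c d k m r s :: int and p :: nat
  assumes p: "prime p" "p > 3" and rs: "r + s = 2 * k" "int p * r + s = 24 * m"
    and det: "a * d - b * c = 1" and a: "[a = 1] (mod int p)" and c: "[c = 0] (mod int p)"
    and t: "Im t > 0"
  defines "f \<equiv> (\<lambda>z. dedekind_eta z powi r * dedekind_eta (of_nat p * z) powi s)"
  shows "f ((of_int a * t + of_int b) / (of_int c * t + of_int d)) = (of_int c * t + of_int d) powi k * f t"
proof -
  have "odd p" using p prime_odd_nat by auto
  then obtain h where h: "p = 2 * h + 1" by (elim oddE)
  obtain c' where c': "c = int p * c'"
    using c by (auto simp: cong_0_iff elim!: dvdE)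
  define J where "J = of_int c * t + of_int d"
  define t' where "t' = (of_int a * t + of_int b) / J"
  have J: "J \<noteq> 0" and t': "Im t' > 0"
    unfolding J_def t'_def using moebius_denom_nonzero[OF det t] Im_moebius_pos[OF det t] by simp_all
  have f_eq: "f z = (((-1) ^ h) powi r) * klein_product h z powi r * (dedekind_eta (of_nat p * z) ^ 24) powi m" if "Im z > 0" for z
  proof -
    have nz: "dedekind_eta (of_nat p * z) \<noteq> 0"
      using that p by (intro dedekind_eta_nonzero) auto
    have eta_z: "dedekind_eta z = (-1) ^ h * klein_product h z * dedekind_eta (of_nat p * z) ^ p"
      using dedekind_eta_eq_klein_product[OF that, of h] unfolding h [symmetric] .
    have "f z = ((-1) ^ h) powi r * klein_product h z powi r * 
        (dedekind_eta (of_nat p * z) powi (int p * r) * dedekind_eta (of_nat p * z) powi s)"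
      unfolding f_def by (subst eta_z) (simp add: power_int_mult_distrib power_int_mult)
    also have "dedekind_eta (of_nat p * z) powi (int p * r) * dedekind_eta (of_nat p * z) powi s = (dedekind_eta (of_nat p * z) ^ 24) powi m"
      unfolding power_int_add[OF disjI1[OF nz], symmetric] rs(2) by (simp add: power_int_mult)
    finally show ?thesis .
  qed
  have K: "klein_product h t' = klein_product h t / J ^ h"
    unfolding t'_def J_def c' using det c' by (intro klein_product_moebius p h a t) auto
  have "Im (of_nat p * t) > 0" using p t by simp
  moreover have "a * d - (int p * b) * c' = 1" using det c' by (simp add: algebra_simps)
  ultimately have "dedekind_eta ((of_int a * (of_nat p * t) + of_int (int p * b)) / (of_int c' * (of_nat p * t) + of_int d)) ^ 24 =
       (of_int c' * (of_nat p * t) + of_int d) ^ 12 * dedekind_eta (of_nat p * t) ^ 24"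
    by (intro dedekind_eta_moebius_power24)
  moreover have "of_int c' * (of_nat p * t) + of_int d = J"
    by (simp add: J_def c')
  moreover have "(of_int a * (of_nat p * t) + of_int (int p * b)) / J = of_nat p * t'"
    by (simp add: t'_def algebra_simps)
  ultimately have E: "dedekind_eta (of_nat p * t') ^ 24 = J ^ 12 * dedekind_eta (of_nat p * t) ^ 24"
    by simp
  have k: "k = 12 * m - int h * r"
    using rs by (simp add: h algebra_simps)
  have "f t' = (J powi (12 * m) / J powi (int h * r)) * f t"
    unfolding f_eq[OF t'] f_eq[OF t] K E
    by (simp add: power_int_mult_distrib power_int_divide_distrib power_int_mult)
  also have "J powi (12 * m) / J powi (int h * r) = J powi k"
    unfolding k using J by (simp add: power_int_diff)
  finally show ?thesis by (simp add: t'_def J_def)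
qed

section \<open>Behaviour at the cusps\<close>

text \<open>In the variable \<open>q = e2pi (z / N)\<close>, a periodic function becomes a holomorphic function on the
  punctured unit disc, and the growth condition bounds the order of its pole at 0.\<close>

lemma periodic_moderate_growth_expansion:
  fixes F :: "complex \<Rightarrow> complex" and N :: nat
  assumes "N > 0" and hol: "F holomorphic_on upper_half_plane"
    and per: "\<And>z. Im z > 0 \<Longrightarrow> F (z + of_nat N) = F z"
    and bound: "\<And>z. Im z \<ge> y0 \<Longrightarrow> norm (F z) \<le> C * exp (M * Im z)" and y0: "y0 > 0"
  shows "\<exists>a :: int \<Rightarrow> complex. finite {n. n < 0 \<and> a n \<noteq> 0} \<and>
    (\<forall>z\<in>upper_half_plane.
       ((\<lambda>n. a n * exp (2 * of_real pi * \<i> * of_int n * z / of_nat N)) has_sum F z) UNIV)"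
proof -
  \<comment> \<open>\<open>L w\<close> is the point \<open>z\<close> with
    \<open>2 \<pi> \<i> z / N = w\<close>. Thus \<open>G\<close> is \<open>F\<close> in the variable
    \<open>q\<close>; by periodicity the branch of the logarithm does not matter.\<close>
  define L where "L = (\<lambda>w. of_nat N * w / (2 * of_real pi * \<i>))"
  define G where "G = (\<lambda>q. F (L (Ln q)))"
  have Im_pos: "Im z > 0" if "norm (e2pi (z / of_nat N)) < 1" for z
    using that \<open>N > 0\<close> by (simp add: norm_e2pi zero_less_mult_iff zero_less_divide_iff)
  have exL: "e2pi (L w / of_nat N) = exp w" for w
    using \<open>N > 0\<close> by (simp add: L_def e2pi_def)
  have per_int: "F (z + of_int n * of_nat N) = F z" if "Im z > 0" for z n
    using that
  proof (induction n rule: int_induct[where k = 0])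
    case (step1 i)
    thus ?case using per[of "z + of_int i * of_nat N"] by (simp add: algebra_simps)
  next
    case (step2 i)
    thus ?case using per[of "z + of_int (i - 1) * of_nat N"] by (simp add: algebra_simps)
  qed auto
  have G_eq: "G (exp w) = F (L w)" if "norm (exp w) < 1" for w
  proof -
    have "exp (Ln (exp w)) = exp w" by simp
    then obtain n :: int where n: "Ln (exp w) = w + of_int (2 * n) * of_real pi * \<i>"
      unfolding exp_eq by auto
    have "L (Ln (exp w)) = L w + of_int n * of_nat N"
      unfolding n by (simp add: L_def field_simps)
    thus ?thesis
      unfolding G_def using per_int[of "L w" n] Im_pos[of "L w"] that by (simp add: exL)
  qed
  have F_eq: "F z = G (e2pi (z / of_nat N))" if "Im z > 0" for z
  proof -
    have "norm (exp (2 * of_real pi * \<i> * (z / of_nat N))) < 1"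
      using that \<open>N > 0\<close> by simp
    from G_eq[OF this] show ?thesis
      using \<open>N > 0\<close> by (simp add: e2pi_def L_def)
  qed
  have holG: "G holomorphic_on ball 0 1 - {0}"
  proof -
    have "G field_differentiable at q0" if q0: "q0 \<in> ball 0 1 - {0}" for q0
    proof -
      \<comment> \<open>On this disc \<open>q / q0\<close> avoids the cut of \<open>Ln\<close>, so
        \<open>Ln (q / q0) + Ln q0\<close> is a holomorphic logarithm even when \<open>q0\<close> is
        negative.\<close>
      define U where "U = ball 0 1 \<inter> ball q0 (norm q0)"
      have "open U" "q0 \<in> U" using q0 by (auto simp: U_def)
      have nonpos: "q / q0 \<notin> \<real>\<^sub>\<le>\<^sub>0" if "q \<in> U" for q
      proof
        assume "q / q0 \<in> \<real>\<^sub>\<le>\<^sub>0"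
        then obtain x where x: "q / q0 = of_real x" "x \<le> 0"
          by (auto elim!: nonpos_Reals_cases)
        hence "q0 - q = of_real (1 - x) * q0"
          using q0 by (simp add: field_simps)
        hence "norm (q0 - q) = (1 - x) * norm q0"
          using x by (simp add: norm_mult del: of_real_diff)
        also have "\<dots> \<ge> 1 * norm q0"
          using x by (intro mult_right_mono) auto
        finally show False using that by (simp add: U_def dist_norm)
      qed
      have exp_branch: "exp (Ln (q / q0) + Ln q0) = q" if "q \<in> U" for q
      proof -
        have "q / q0 \<noteq> 0" using nonpos[OF that] by auto
        thus ?thesis using q0 by (simp add: exp_add)
      qed
      have "(\<lambda>q. F (L (Ln (q / q0) + Ln q0))) holomorphic_on U"
      proof -
        have "F \<circ> (\<lambda>q. L (Ln (q / q0) + Ln q0)) holomorphic_on U"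
        proof (rule holomorphic_on_compose_gen[OF _ hol])
          show "(\<lambda>q. L (Ln (q / q0) + Ln q0)) holomorphic_on U"
            unfolding L_def using nonpos q0 by (intro holomorphic_intros) auto
          show "(\<lambda>q. L (Ln (q / q0) + Ln q0)) ` U \<subseteq> upper_half_plane"
          proof safe
            fix q assume "q \<in> U"
            thus "L (Ln (q / q0) + Ln q0) \<in> upper_half_plane"
              unfolding upper_half_plane_def mem_Collect_eq
              by (intro Im_pos) (simp add: exL exp_branch, simp add: U_def)
          qed
        qed
        thus ?thesis by (simp add: o_def)
      qed
      moreover have "F (L (Ln (q / q0) + Ln q0)) = G q" if "q \<in> U" for q
        using G_eq[of "Ln (q / q0) + Ln q0"] that exp_branch[OF that] by (simp add: U_def)
      ultimately have "G holomorphic_on U"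
        by (rule holomorphic_transform)
      thus ?thesis
        using \<open>open U\<close> \<open>q0 \<in> U\<close> by (rule holomorphic_on_imp_differentiable_at)
    qed
    thus ?thesis
      by (intro holomorphic_on_open[THEN iffD2]) (auto simp: field_differentiable_def)
  qed
  \<comment> \<open>A bound for the order of the pole: \<open>q ^ m\<close> compensates the growth
    \<open>exp (M * Im z)\<close>.\<close>
  define m where "m = nat \<lceil>M * N / (2 * pi)\<rceil>"
  have m: "M * N \<le> 2 * pi * m"
  proof -
    have "M * N / (2 * pi) \<le> real m"
      unfolding m_def by (rule real_nat_ceiling_ge)
    thus ?thesis by (simp add: field_simps)
  qed
  define H where "H = (\<lambda>q. q ^ m * G q)"
  have holH: "H holomorphic_on ball 0 1 - {0}"
    unfolding H_def by (intro holomorphic_intros holG)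
  define \<rho> where "\<rho> = exp (- 2 * pi * y0 / N)"
  have C: "C \<ge> 0"
    using order_trans[OF norm_ge_zero bound[of "\<i> * y0"]] by (simp add: zero_le_mult_iff)
  have "norm (H q) \<le> C" if q: "q \<noteq> 0" "norm q \<le> \<rho>" for q
  proof -
    define z where "z = L (Ln q)"
    have ez: "e2pi (z / of_nat N) = q"
      using q by (simp add: z_def exL)
    have nq: "norm q = exp (- 2 * pi * Im z / N)"
      unfolding ez [symmetric] norm_e2pi by simp
    have "y0 \<le> Im z"
      using q(2) \<open>N > 0\<close> unfolding nq \<rho>_def by (simp add: divide_le_cancel)
    hence "norm (F z) \<le> C * exp (M * Im z)" and Imz: "Im z > 0"
      using bound y0 by auto
    moreover have "norm (q ^ m) = exp (- 2 * pi * m * Im z / N)"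
      unfolding norm_power nq exp_of_nat_mult [symmetric] by (simp add: mult_ac)
    ultimately have "norm (H q) \<le> exp (- 2 * pi * m * Im z / N) * (C * exp (M * Im z))"
      unfolding H_def norm_mult G_def z_def [symmetric] by (intro mult_mono) auto
    also have "\<dots> = C * exp (M * Im z - 2 * pi * m * Im z / N)"
      by (simp add: exp_diff exp_minus field_simps)
    also have "\<dots> \<le> C * exp 0"
    proof -
      have "M * Im z - 2 * pi * m * Im z / N = (M * N - 2 * pi * m) * Im z / N"
        using \<open>N > 0\<close> by (simp add: field_simps)
      also have "\<dots> \<le> 0"
        using m Imz by (intro divide_nonpos_nonneg mult_nonpos_nonneg) auto
      finally show ?thesis using C by (intro mult_left_mono) auto
    qed
    finally show ?thesis by simp
  qed
  hence "eventually (\<lambda>q. norm (H q) \<le> C) (at 0)"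
    unfolding eventually_at by (intro exI[of _ \<rho>]) (auto simp: \<rho>_def)
  hence "\<exists>g. g holomorphic_on ball 0 1 \<and> (\<forall>q\<in>ball 0 1 - {0}. g q = H q)"
    by (subst holomorphic_on_extend_bounded[OF holH]) auto
  then obtain g where g: "g holomorphic_on ball 0 1" "\<And>q. q \<in> ball 0 1 - {0} \<Longrightarrow> g q = H q"
    by blast
  define c where "c = (\<lambda>n. (deriv ^^ n) g 0 / fact n)"
  have sums: "(\<lambda>n. c n * q ^ n) sums g q" if "q \<in> ball 0 1" for q
    using holomorphic_power_series[OF g(1) that] by (simp add: c_def)
  have has_sum: "((\<lambda>n. c n * q ^ n) has_sum g q) UNIV" if q: "q \<in> ball 0 1" for q
  proof (rule norm_summable_imp_has_sum[OF _ sums[OF q]])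
    \<comment> \<open>A point strictly between \<open>norm q\<close> and 1 in absolute value;
      convergence there gives absolute convergence at \<open>q\<close>.\<close>
    define x where "x = complex_of_real ((norm q + 1) / 2)"
    have "norm x = (norm q + 1) / 2"
      unfolding x_def norm_of_real by simp
    hence "x \<in> ball 0 1" "norm q < norm x"
      using q by auto
    thus "summable (\<lambda>n. norm (c n * q ^ n))"
      using sums[of x] by (intro powser_insidea[of c x]) (auto simp: sums_iff)
  qed
  \<comment> \<open>The Taylor coefficients of \<open>g\<close>, shifted by \<open>m\<close> to undo
    the factor \<open>q ^ m\<close>.\<close>
  define a where "a = (\<lambda>n. if n \<ge> - int m then c (nat (n + int m)) else 0)"
  have "{n. n < 0 \<and> a n \<noteq> 0} \<subseteq> {- int m..<0}"
    by (auto simp: a_def split: if_splits)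
  hence "finite {n. n < 0 \<and> a n \<noteq> 0}"
    by (rule finite_subset) auto
  moreover have "((\<lambda>n. a n * exp (2 * of_real pi * \<i> * of_int n * z / of_nat N)) has_sum F z) UNIV"
    if "z \<in> upper_half_plane" for z
  proof -
    define q where "q = e2pi (z / of_nat N)"
    have Imz: "Im z > 0" using that by (simp add: upper_half_plane_def)
    have q: "q \<noteq> 0" "q \<in> ball 0 1"
      using Imz \<open>N > 0\<close> by (simp_all add: q_def norm_e2pi)
    define h where "h = (\<lambda>n. int n - int m)"
    have e: "exp (2 * of_real pi * \<i> * of_int n * z / of_nat N) = q powi n" for n
      by (simp add: q_def e2pi_power_int) (simp add: e2pi_def mult_ac)
    have "((\<lambda>n. inverse (q ^ m) * (c n * q ^ n)) has_sum inverse (q ^ m) * g q) UNIV"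
      by (intro has_sum_cmult_right has_sum q)
    also have "inverse (q ^ m) * g q = F z"
      using g(2)[of q] q F_eq[OF Imz] by (simp add: H_def q_def)
    also have "(\<lambda>n. inverse (q ^ m) * (c n * q ^ n)) = (\<lambda>n. a n * q powi n) \<circ> h"
      using q by (auto simp: fun_eq_iff a_def h_def power_int_diff field_simps)
    finally have "((\<lambda>n. a n * q powi n) has_sum F z) (range h)"
      using has_sum_reindex[of h UNIV] by (auto simp: h_def inj_on_def o_def)
    moreover have "a n = 0" if "n \<notin> range h" for n
    proof (rule ccontr)
      assume "a n \<noteq> 0"
      hence "n = h (nat (n + int m))"
        by (auto simp: a_def h_def split: if_splits)
      thus False using that by blast
    qed
    hence "((\<lambda>n. a n * q powi n) has_sum F z) (range h) \<longleftrightarrow> ((\<lambda>n. a n * q powi n) has_sum F z) UNIV"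
      by (intro has_sum_cong_neutral) auto
    ultimately have "((\<lambda>n. a n * q powi n) has_sum F z) UNIV"
      by blast
    thus ?thesis by (simp add: e)
  qed
  ultimately show ?thesis by blast
qed

section \<open>Growth of eta quotients at the cusps\<close>

lemma holomorphic_on_dedekind_eta:
  assumes "f holomorphic_on S" "open S" "\<And>z. z \<in> S \<Longrightarrow> Im (f z) > 0"
  shows "(\<lambda>z. dedekind_eta (f z)) holomorphic_on S"
  unfolding dedekind_eta_altdef by (intro holomorphic_intros assms norm_e2pi_less_1) auto

text \<open>For \<open>Im t \<ge> y0\<close> the nome stays in a compact disc inside the unit disc.
  The Euler product has no zero there, so its powers are bounded for negative \<open>r\<close>
  too.\<close>

lemma dedekind_eta_powi_bound:
  assumes "y0 > 0"
  shows "\<exists>C\<ge>0. \<forall>t. Im t \<ge> y0 \<longrightarrow> norm (dedekind_eta t powi r) \<le> C * exp (- pi * of_int r / 12 * Im t)"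
proof -
  define \<rho> where "\<rho> = exp (- 2 * pi * y0)"
  have \<rho>: "\<rho> < 1" using assms by (simp add: \<rho>_def)
  have "(\<lambda>q. qprod 1 q powi r) holomorphic_on ball 0 1"
    by (intro holomorphic_intros) (auto simp: qprod_one_nonzero)
  hence "continuous_on (cball 0 \<rho>) (\<lambda>q. qprod 1 q powi r)"
    by (rule continuous_on_subset[OF holomorphic_on_imp_continuous_on]) (use \<rho> in auto)
  hence "bounded ((\<lambda>q. qprod 1 q powi r) ` cball 0 \<rho>)"
    by (intro compact_imp_bounded compact_continuous_image) auto
  then obtain C where C: "C > 0" "\<And>q. q \<in> cball 0 \<rho> \<Longrightarrow> norm (qprod 1 q powi r) \<le> C"
    unfolding bounded_pos by blast
  have "norm (dedekind_eta t powi r) \<le> C * exp (- pi * of_int r / 12 * Im t)" if "Im t \<ge> y0" for t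
  proof -
    have "norm (dedekind_eta t powi r) = exp (- pi * of_int r / 12 * Im t) * norm (qprod 1 (e2pi t) powi r)"
      unfolding dedekind_eta_altdef power_int_mult_distrib e2pi_power_int norm_mult norm_e2pi by (simp add: mult_ac)
    also have "\<dots> \<le> exp (- pi * of_int r / 12 * Im t) * C"
      using that by (intro mult_left_mono C(2)) (auto simp: norm_e2pi \<rho>_def)
    finally show ?thesis by (simp add: mult_ac)
  qed
  thus ?thesis using C(1) by (intro exI[of _ C]) auto
qed

text \<open>The product of \<open>diag(p, 1)\<close> and the given matrix is an element of
  \<open>SL2Z\<close> times an upper triangular matrix of determinant \<open>p\<close>:
  \<open>diag(p, 1)\<close> if \<open>p\<close> divides \<open>c\<close>, otherwise the one with
  rows \<open>(1, j)\<close> and \<open>(0, p)\<close>.\<close>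

lemma norm_dedekind_eta_scaled_moebius:
  fixes a b c d :: int and p :: nat
  assumes "prime p" and det: "a * d - b * c = 1"
  shows "\<exists>\<kappa> \<sigma> \<mu> :: real. \<kappa> > 0 \<and> \<sigma> > 0 \<and> (\<forall>t. Im t > 0 \<longrightarrow>
     (norm (dedekind_eta (of_nat p * ((of_int a * t + of_int b) / (of_int c * t + of_int d)))))\<^sup>2 =
       \<kappa> * norm (of_int c * t + of_int d) * (norm (dedekind_eta (of_real \<sigma> * t + of_real \<mu>)))\<^sup>2)"
proof (cases "int p dvd c")
  case True
  then obtain c' where c': "c = int p * c'" by (elim dvdE)
  have p: "p > 0" using assms by (simp add: prime_gt_0_nat)
  have "(norm (dedekind_eta (of_nat p * ((of_int a * t + of_int b) / (of_int c * t + of_int d)))))\<^sup>2 =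
       1 * norm (of_int c * t + of_int d) * (norm (dedekind_eta (of_real (real p) * t + of_real 0)))\<^sup>2" if "Im t > 0" for t
  proof -
    have "a * d - (int p * b) * c' = 1" using det by (simp add: c' algebra_simps)
    moreover have "Im (of_nat p * t) > 0" using that p by simp
    ultimately have "(norm (dedekind_eta ((of_int a * (of_nat p * t) + of_int (int p * b)) / (of_int c' * (of_nat p * t) + of_int d))))\<^sup>2 =
           norm (of_int c' * (of_nat p * t) + of_int d) * (norm (dedekind_eta (of_nat p * t)))\<^sup>2"
      by (rule norm_dedekind_eta_moebius)
    moreover have "of_int c' * (of_nat p * t) + of_int d = of_int c * t + of_int d"
      by (simp add: c')
    moreover have "(of_int a * (of_nat p * t) + of_int (int p * b)) = of_nat p * (of_int a * t + of_int b)"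
      by (simp add: algebra_simps)
    ultimately show ?thesis by simp
  qed
  thus ?thesis using p by (intro exI[of _ 1] exI[of _ "real p"] exI[of _ 0]) simp
next
  case False
  have p: "p > 0" using assms by (simp add: prime_gt_0_nat)
  have "coprime (int p) c"
    using assms(1) False by (intro prime_imp_coprime) auto
  \<comment> \<open>With \<open>c\<close> invertible modulo \<open>p\<close>, this choice makes the
    lower right entry \<open>(d - c j) / p\<close> an integer.\<close>
  then obtain j where "[c * j = d] (mod int p)"
    using cong_solve_coprime_int[of c "int p"] by (metis cong_scalar_left coprime_commute mult.assoc mult.commute mult_1)
  then obtain e where e: "d = c * j + int p * e"
    by (metis cong_iff_lin)
  have "(norm (dedekind_eta (of_nat p * ((of_int a * t + of_int b) / (of_int c * t + of_int d)))))\<^sup>2 =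
       1 / real p * norm (of_int c * t + of_int d) * (norm (dedekind_eta (of_real (1 / real p) * t + of_real (of_int j / real p))))\<^sup>2" if "Im t > 0" for t
  proof -
    define w where "w = (t + of_int j) / of_nat p"
    have "int p * a * e - (b - a * j) * c = 1" using det by (simp add: e algebra_simps)
    moreover have "Im w > 0" using that p by (simp add: w_def)
    ultimately have "(norm (dedekind_eta ((of_int (int p * a) * w + of_int (b - a * j)) / (of_int c * w + of_int e))))\<^sup>2 =
           norm (of_int c * w + of_int e) * (norm (dedekind_eta w))\<^sup>2"
      by (rule norm_dedekind_eta_moebius)
    moreover have denom: "of_int c * w + of_int e = (of_int c * t + of_int d) / of_nat p"
      using p by (simp add: w_def e field_simps)
    moreover have "of_int (int p * a) * w + of_int (b - a * j) = of_int a * t + of_int b"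
      using p by (simp add: w_def field_simps)
    hence "(of_int (int p * a) * w + of_int (b - a * j)) / (of_int c * w + of_int e) =
        of_nat p * ((of_int a * t + of_int b) / (of_int c * t + of_int d))"
      unfolding denom by simp
    moreover have "w = of_real (1 / real p) * t + of_real (of_int j / real p)"
      by (simp add: w_def add_divide_distrib)
    moreover have "norm ((of_int c * t + of_int d) / of_nat p) = 1 / real p * norm (of_int c * t + of_int d)"
      by (simp add: norm_divide)
    ultimately show ?thesis
      by (simp only:)
  qed
  thus ?thesis using p by (intro exI[of _ "1 / real p"] exI[of _ "of_int j / real p"]) simp
qed

text \<open>After squaring, all powers of \<open>norm J\<close> cancel because
  \<open>r + s = 2 * k\<close>. What remains are powers of \<open>\<eta>\<close> at \<open>z\<close>
  and at \<open>\<sigma> z + \<mu>\<close>, both bounded exponentially.\<close>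

lemma norm_eta_quotient_slash_bound:
  fixes a b c d k r s :: int and p :: nat
  assumes "prime p" and det: "a * d - b * c = 1" and rs: "r + s = 2 * k"
  defines "f \<equiv> (\<lambda>z. dedekind_eta z powi r * dedekind_eta (of_nat p * z) powi s)"
  shows "\<exists>C M. \<forall>z. Im z \<ge> 1 \<longrightarrow> norm ((of_int c * z + of_int d) powi (- k) *
     f ((of_int a * z + of_int b) / (of_int c * z + of_int d))) \<le> C * exp (M * Im z)"
proof -
  obtain \<kappa> \<sigma> \<mu> :: real where *: "\<kappa> > 0" "\<sigma> > 0" and
    eta_p: "\<And>t. Im t > 0 \<Longrightarrow> (norm (dedekind_eta (of_nat p * ((of_int a * t + of_int b) / (of_int c * t + of_int d)))))\<^sup>2 =
       \<kappa> * norm (of_int c * t + of_int d) * (norm (dedekind_eta (of_real \<sigma> * t + of_real \<mu>)))\<^sup>2"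
    using norm_dedekind_eta_scaled_moebius[OF assms(1) det] by metis
  obtain C1 where C1: "C1 \<ge> 0" "\<And>t. Im t \<ge> 1 \<Longrightarrow> norm (dedekind_eta t powi r) \<le> C1 * exp (- pi * of_int r / 12 * Im t)"
    using dedekind_eta_powi_bound[of 1 r] by auto
  obtain C2 where C2: "C2 \<ge> 0" "\<And>t. Im t \<ge> \<sigma> \<Longrightarrow> norm (dedekind_eta t powi s) \<le> C2 * exp (- pi * of_int s / 12 * Im t)"
    using dedekind_eta_powi_bound[OF *(2), of s] by auto
  define C where "C = sqrt (\<kappa> powi s) * (C1 * C2)"
  define M where "M = - pi * of_int r / 12 - pi * of_int s / 12 * \<sigma>"
  have "norm ((of_int c * z + of_int d) powi (- k) * f ((of_int a * z + of_int b) / (of_int c * z + of_int d))) \<le> C * exp (M * Im z)"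
    if z: "Im z \<ge> 1" for z
  proof (rule power2_le_imp_le)
    have Imz: "Im z > 0" using z by simp
    define J where "J = of_int c * z + of_int d"
    define z' where "z' = (of_int a * z + of_int b) / J"
    define w where "w = of_real \<sigma> * z + of_real \<mu>"
    have J: "norm J \<noteq> 0" using moebius_denom_nonzero[OF det Imz] by (simp add: J_def)
    have Imw: "Im w = \<sigma> * Im z" by (simp add: w_def)
    have n1: "(norm (dedekind_eta z'))\<^sup>2 = norm J * (norm (dedekind_eta z))\<^sup>2"
      unfolding z'_def J_def by (rule norm_dedekind_eta_moebius[OF det Imz])
    have n2: "(norm (dedekind_eta (of_nat p * z')))\<^sup>2 = \<kappa> * norm J * (norm (dedekind_eta w))\<^sup>2"
      unfolding z'_def J_def w_def by (rule eta_p[OF Imz])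
    have sq: "(x powi n)\<^sup>2 = (x\<^sup>2) powi n" for x :: real and n
      by (simp add: power2_eq_square power_int_mult_distrib)
    have "(norm (J powi (- k) * f z'))\<^sup>2 = ((norm J)\<^sup>2) powi (- k) * (((norm (dedekind_eta z'))\<^sup>2) powi r * ((norm (dedekind_eta (of_nat p * z')))\<^sup>2) powi s)"
      unfolding f_def norm_mult norm_power_int power_mult_distrib sq ..
    also have "\<dots> = ((norm J)\<^sup>2) powi (- k) * (norm J powi r * norm J powi s) * (\<kappa> powi s * ((norm (dedekind_eta z powi r))\<^sup>2 * (norm (dedekind_eta w powi s))\<^sup>2))"
      unfolding n1 n2 by (simp add: power_int_mult_distrib norm_power_int sq mult_ac)
    also have "((norm J)\<^sup>2) powi (- k) * (norm J powi r * norm J powi s) = 1"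
    proof -
      have "((norm J)\<^sup>2) powi (- k) = norm J powi (- (r + s))"
        unfolding rs by (simp add: power_int_power)
      thus ?thesis using J by (simp flip: power_int_add)
    qed
    also have "1 * (\<kappa> powi s * ((norm (dedekind_eta z powi r))\<^sup>2 * (norm (dedekind_eta w powi s))\<^sup>2)) \<le>
        \<kappa> powi s * ((C1 * exp (- pi * of_int r / 12 * Im z))\<^sup>2 * (C2 * exp (- pi * of_int s / 12 * Im w))\<^sup>2)"
      unfolding mult_1 using z * Imw C1(1) C2(1)
      by (intro mult_left_mono mult_mono power_mono C1(2) C2(2)) auto
    also have "\<dots> = \<kappa> powi s * (C1 * C2 * exp (M * Im z))\<^sup>2"
    proof -
      have "M * Im z = - pi * of_int r / 12 * Im z + - pi * of_int s / 12 * Im w"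
        unfolding M_def Imw by (simp add: algebra_simps)
      hence "exp (M * Im z) = exp (- pi * of_int r / 12 * Im z) * exp (- pi * of_int s / 12 * Im w)"
        by (simp only: exp_add)
      thus ?thesis by (simp only: power_mult_distrib mult_ac)
    qed
    also have "\<dots> = (C * exp (M * Im z))\<^sup>2"
      using * by (simp add: C_def power_mult_distrib mult_ac)
    finally show "(norm ((of_int c * z + of_int d) powi (- k) * f ((of_int a * z + of_int b) / (of_int c * z + of_int d))))\<^sup>2 \<le> (C * exp (M * Im z))\<^sup>2"
      by (simp only: J_def z'_def)
    show "C * exp (M * Im z) \<ge> 0"
      using * C1(1) C2(1) by (simp add: C_def)
  qed
  thus ?thesis by blast
qed

section \<open>Eta quotients\<close>

lemma SL2Z_iff: "A \<in> SL2Z \<longleftrightarrow> A $ 1 $ 1 * A $ 2 $ 2 - A $ 1 $ 2 * A $ 2 $ 1 = 1"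
  by (simp add: SL2Z_def det_2)

lemma eta_quotient_holomorphic:
  fixes p :: nat and r s :: int
  assumes "p > 0" "g holomorphic_on S" "open S" "\<And>z. z \<in> S \<Longrightarrow> Im (g z) > 0"
  shows "(\<lambda>z. dedekind_eta (g z) powi r * dedekind_eta (of_nat p * g z) powi s) holomorphic_on S"
  using assms by (intro holomorphic_intros holomorphic_on_dedekind_eta) (auto simp: dedekind_eta_nonzero)

lemma eta_quotient_weakly_holomorphic:
  fixes p :: nat and k m r s :: int
  assumes p: "prime p" "p > 3" and rs: "r + s = 2 * k" "int p * r + s = 24 * m"
  shows "weakly_holomorphic_modular_form p k
    (\<lambda>z. dedekind_eta z powi r * dedekind_eta (of_nat p * z) powi s)"
proof -
  define f where "f = (\<lambda>z. dedekind_eta z powi r * dedekind_eta (of_nat p * z) powi s)"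
  have p0: "p > 0" using p by simp
  have openH: "open upper_half_plane"
    unfolding upper_half_plane_def by (rule open_halfspace_Im_gt)
  have invariant: "f ((of_int a * t + of_int b) / (of_int c * t + of_int d)) = (of_int c * t + of_int d) powi k * f t"
    if "a * d - b * c = 1" "[a = 1] (mod int p)" "[c = 0] (mod int p)" "Im t > 0" for a b c d :: int and t
    unfolding f_def by (rule eta_quotient_Gamma1[OF p rs that])
  have "f holomorphic_on upper_half_plane"
    unfolding f_def by (intro eta_quotient_holomorphic p0 openH) (auto simp: upper_half_plane_def)
  moreover have "slash k f A z = f z" if "A \<in> Gamma1 p" "z \<in> upper_half_plane" for A z
  proof -
    have det: "A $ 1 $ 1 * A $ 2 $ 2 - A $ 1 $ 2 * A $ 2 $ 1 = 1" and z: "Im z > 0"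
      and cong: "[A $ 1 $ 1 = 1] (mod int p)" "[A $ 2 $ 1 = 0] (mod int p)"
      using that by (auto simp: Gamma1_def SL2Z_iff upper_half_plane_def)
    show ?thesis
      unfolding slash_def invariant[OF det cong z] using moebius_denom_nonzero[OF det z]
      by (simp add: power_int_minus)
  qed
  moreover have "meromorphic_at_cusps p k f"
    unfolding meromorphic_at_cusps_def
  proof
    fix A assume A: "A \<in> SL2Z"
    define a b c d where "a = A $ 1 $ 1" and "b = A $ 1 $ 2" and "c = A $ 2 $ 1" and "d = A $ 2 $ 2"
    note abcd = a_def b_def c_def d_def
    have det: "a * d - b * c = 1"
      using A by (simp add: SL2Z_iff abcd)
    have slash: "slash k f A = (\<lambda>z. (of_int c * z + of_int d) powi (- k) *
        f ((of_int a * z + of_int b) / (of_int c * z + of_int d)))"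
      unfolding slash_def abcd ..
    have "\<exists>C M. \<forall>z. Im z \<ge> 1 \<longrightarrow> norm (slash k f A z) \<le> C * exp (M * Im z)"
      unfolding slash unfolding f_def by (rule norm_eta_quotient_slash_bound[OF p(1) det rs(1)])
    then obtain C M where bound: "\<And>z. Im z \<ge> 1 \<Longrightarrow> norm (slash k f A z) \<le> C * exp (M * Im z)"
      by blast
    show "\<exists>a. finite {n. n < 0 \<and> a n \<noteq> 0} \<and> (\<forall>z\<in>upper_half_plane.
       ((\<lambda>n. a n * exp (2 * of_real pi * \<i> * of_int n * z / of_nat p)) has_sum slash k f A z) UNIV)"
    proof (rule periodic_moderate_growth_expansion[OF p0 _ _ bound])
      show "slash k f A holomorphic_on upper_half_plane"
        unfolding slash unfolding f_def using moebius_denom_nonzero[OF det] Im_moebius_pos[OF det]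
        by (intro holomorphic_on_mult eta_quotient_holomorphic openH p0 holomorphic_on_power_int
              holomorphic_on_divide holomorphic_on_add holomorphic_on_const holomorphic_on_ident)
           (auto simp: upper_half_plane_def)
      fix z assume z: "Im z > 0"
      define J where "J = of_int c * z + of_int d"
      define X where "X = of_int a * z + of_int b"
      have J: "J \<noteq> 0" and Im: "Im (X / J) > 0"
        unfolding J_def X_def using moebius_denom_nonzero[OF det z] Im_moebius_pos[OF det z] by auto
      have "Im (z + of_nat p) > 0" using z by simp
      hence J': "J + of_nat p * of_int c \<noteq> 0"
        using moebius_denom_nonzero[OF det, of "z + of_nat p"] by (simp add: J_def algebra_simps)
      have det': "of_int a * J - of_int c * X = 1"
      proof -
        have "of_int a * of_int d - of_int b * of_int c = (1 :: complex)"
          using det by (metis of_int_1 of_int_diff of_int_mult)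
        thus ?thesis unfolding J_def X_def by algebra
      qed
      \<comment> \<open>the conjugate of the translation by \<open>p\<close> under \<open>A\<close> lies in \<open>Gamma1 p\<close>\<close>
      define a' b' c' d' where "a' = 1 - int p * (a * c)" and "b' = int p * a\<^sup>2" and "c' = int p * (- c\<^sup>2)" and "d' = 1 + int p * (a * c)"
      \<comment> \<open>\<open>X / J\<close> is the image of \<open>z\<close> under
        \<open>A\<close>; \<open>num\<close> and \<open>denom\<close> show that the conjugate sends
        it to the image of \<open>z + p\<close>.\<close>
      have num: "of_int a' * (X / J) + of_int b' = (X + of_nat p * of_int a) / J"
      proof -
        have "of_int a' * X + of_int b' * J = X + of_nat p * of_int a"
          using det' unfolding a'_def b'_def by simp algebra
        thus ?thesis using J by (simp add: field_simps)
      qed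
      have denom: "of_int c' * (X / J) + of_int d' = (J + of_nat p * of_int c) / J"
      proof -
        have "of_int c' * X + of_int d' * J = J + of_nat p * of_int c"
          using det' unfolding c'_def d'_def by simp algebra
        thus ?thesis using J by (simp add: field_simps)
      qed
      have "f ((of_int a' * (X / J) + of_int b') / (of_int c' * (X / J) + of_int d')) = (of_int c' * (X / J) + of_int d') powi k * f (X / J)"
        by (rule invariant[OF _ _ _ Im])
           (auto simp: a'_def b'_def c'_def d'_def cong_iff_dvd_diff power2_eq_square algebra_simps)
      hence f_eq: "f ((X + of_nat p * of_int a) / (J + of_nat p * of_int c)) = ((J + of_nat p * of_int c) / J) powi k * f (X / J)"
        unfolding num denom using J by simp
      have slash1: "slash k f A (z + of_nat p) = (J + of_nat p * of_int c) powi (- k) * f ((X + of_nat p * of_int a) / (J + of_nat p * of_int c))"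
        by (simp add: slash X_def J_def algebra_simps)
      have slash2: "slash k f A z = J powi (- k) * f (X / J)"
        by (simp add: slash X_def J_def)
      show "slash k f A (z + of_nat p) = slash k f A z"
        unfolding slash1 slash2 f_eq using J J' by (simp add: power_int_divide_distrib power_int_minus field_simps)
    qed auto
  qed
  ultimately show ?thesis
    unfolding weakly_holomorphic_modular_form_def f_def by blast
qed

section \<open>Necessary conditions on the exponents\<close>

lemma dedekind_eta_add_of_nat: "dedekind_eta (t + of_nat n) = e2pi (of_nat n / 24) * dedekind_eta t"
  using e2pi_of_int[of "int n"] by (simp add: dedekind_eta_altdef add_divide_distrib e2pi_add)

text \<open>Invariance is tested at \<open>\<i>\<close>. The translation by 1 multiplies the
  quotient by \<open>e2pi ((r + p s) / 24)\<close>; a lower triangular element compares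
  \<open>norm J powi (r + s)\<close> with \<open>norm J powi (2 * k)\<close>.\<close>

lemma eta_quotient_exponents:
  fixes p :: nat and k r s :: int
  assumes "p > 0" and f: "weakly_holomorphic_modular_form p k
    (\<lambda>z. dedekind_eta z powi r * dedekind_eta (of_nat p * z) powi s)"
  shows "r + s = 2 * k" and "24 dvd r + int p * s"
proof -
  define f where "f = (\<lambda>z. dedekind_eta z powi r * dedekind_eta (of_nat p * z) powi s)"
  have inv: "slash k f A z = f z" if "A \<in> Gamma1 p" "Im z > 0" for A z
    using f that by (simp add: weakly_holomorphic_modular_form_def f_def upper_half_plane_def)
  have nz: "f \<i> \<noteq> 0"
    using assms(1) by (simp add: f_def dedekind_eta_nonzero)
  show "24 dvd r + int p * s"
  proof -
    define T :: "int ^ 2 ^ 2" where "T = vector [vector [1, 1], vector [0, 1]]"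
    have "T \<in> Gamma1 p"
      by (simp add: Gamma1_def SL2Z_iff T_def)
    hence "f (\<i> + 1) = f \<i>"
      using inv[of T \<i>] by (simp add: slash_def T_def)
    moreover have "f (\<i> + 1) = e2pi (of_int (r + int p * s) / 24) * f \<i>"
    proof -
      have "dedekind_eta (\<i> + 1) = e2pi (1 / 24) * dedekind_eta \<i>"
        using dedekind_eta_add_of_nat[of \<i> 1] by simp
      moreover have "dedekind_eta (of_nat p * (\<i> + 1)) = e2pi (of_nat p / 24) * dedekind_eta (of_nat p * \<i>)"
        using dedekind_eta_add_of_nat[of "of_nat p * \<i>" p] by (simp add: algebra_simps)
      moreover have "e2pi (of_int (r + int p * s) / 24) = e2pi (1 / 24) powi r * e2pi (of_nat p / 24) powi s"
        by (simp add: e2pi_power_int e2pi_add add_divide_distrib mult_ac)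
      ultimately show ?thesis
        by (simp add: f_def power_int_mult_distrib)
    qed
    ultimately have "e2pi (of_int (r + int p * s) / 24) = 1"
      using nz by simp
    then obtain n :: int where "of_int (r + int p * s) / 24 = (of_int n :: complex)"
      by (auto simp: e2pi_eq_1_iff)
    hence "(of_int (r + int p * s) :: complex) = of_int (24 * n)"
      by (simp add: field_simps)
    hence "r + int p * s = 24 * n"
      by (simp only: of_int_eq_iff)
    thus ?thesis by simp
  qed
  show "r + s = 2 * k"
  proof -
    define L :: "int ^ 2 ^ 2" where "L = vector [vector [1, 0], vector [int p, 1]]"
    define J where "J = of_nat p * \<i> + 1"
    \<comment> \<open>Since \<open>norm J\<close> exceeds 1, its integer powers determine their
      exponents.\<close>
    have J1: "norm J > 1"
      using assms(1) by (simp add: J_def cmod_def)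
    have "L \<in> Gamma1 p"
      by (simp add: Gamma1_def SL2Z_iff L_def cong_0_iff)
    hence "J powi (- k) * f (\<i> / J) = f \<i>"
      using inv[of L \<i>] by (simp add: slash_def L_def J_def)
    moreover have J0: "J \<noteq> 0" using J1 by auto
    ultimately have eq: "f (\<i> / J) = J powi k * f \<i>"
      by (simp add: power_int_minus divide_simps mult_ac split: if_splits)
    have n1: "(norm (dedekind_eta (\<i> / J)))\<^sup>2 = norm J * (norm (dedekind_eta \<i>))\<^sup>2"
      using norm_dedekind_eta_moebius[of 1 1 0 "int p" \<i>] by (simp add: J_def)
    \<comment> \<open>\<open>p (\<i> / J)\<close> is the image of \<open>p \<i>\<close> under the
      matrix with rows \<open>(1, 0)\<close> and \<open>(1, 1)\<close>.\<close>
    have n2: "(norm (dedekind_eta (of_nat p * (\<i> / J))))\<^sup>2 = norm J * (norm (dedekind_eta (of_nat p * \<i>)))\<^sup>2"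
      using norm_dedekind_eta_moebius[of 1 1 0 1 "of_nat p * \<i>"] assms(1) by (simp add: J_def)
    have sq: "(x powi n)\<^sup>2 = (x\<^sup>2) powi n" for x :: real and n
      by (simp add: power2_eq_square power_int_mult_distrib)
    have "(norm (f (\<i> / J)))\<^sup>2 = norm J powi r * norm J powi s * (norm (f \<i>))\<^sup>2"
      unfolding f_def norm_mult norm_power_int power_mult_distrib sq n1 n2 power_int_mult_distrib by (simp add: mult_ac)
    moreover have "(norm (f (\<i> / J)))\<^sup>2 = norm J powi (2 * k) * (norm (f \<i>))\<^sup>2"
      unfolding eq norm_mult norm_power_int power_mult_distrib by (simp add: power_int_power' mult_ac)
    ultimately have "norm J powi (r + s) = norm J powi (2 * k)"
      using nz J0 by (auto simp: power_int_add)
    thus ?thesis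
      using power_int_strict_increasing[OF _ J1, of "r + s" "2 * k"] power_int_strict_increasing[OF _ J1, of "2 * k" "r + s"]
      by (cases "r + s" "2 * k" rule: linorder_cases) auto
  qed
qed

theorem theorem1p2:
  fixes p :: nat and k :: int
  assumes "prime p" and "p > 3"
  shows "(\<exists>r1 rp :: int. weakly_holomorphic_modular_form p k
            (\<lambda>z. dedekind_eta z powi r1 * dedekind_eta (of_nat p * z) powi rp)) \<longleftrightarrow>
         gcd (int p - 1) 24 div 2 dvd k"
proof -
  define g where "g = gcd (int p - 1) 24"
  have "odd p" using assms prime_odd_nat by auto
  hence "2 dvd g" by (simp add: g_def)
  hence g: "g = 2 * (g div 2)" by simp
  hence dvd_iff: "g div 2 dvd k \<longleftrightarrow> g dvd 2 * k"
    by (metis dvd_mult_cancel_left zero_neq_numeral)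
  have "(\<exists>r s. weakly_holomorphic_modular_form p k
            (\<lambda>z. dedekind_eta z powi r * dedekind_eta (of_nat p * z) powi s)) \<longleftrightarrow> g dvd 2 * k"
  proof
    assume "\<exists>r s. weakly_holomorphic_modular_form p k
            (\<lambda>z. dedekind_eta z powi r * dedekind_eta (of_nat p * z) powi s)"
    then obtain r s where "weakly_holomorphic_modular_form p k
            (\<lambda>z. dedekind_eta z powi r * dedekind_eta (of_nat p * z) powi s)"
      by blast
    hence "r + s = 2 * k" "24 dvd r + int p * s"
      using eta_quotient_exponents[of p k r s] assms by auto
    \<comment> \<open>Both terms on the right are multiples of \<open>g\<close>.\<close>
    moreover have "2 * k = (r + int p * s) - (int p - 1) * s"
      using calculation(1) by (simp add: algebra_simps)
    moreover have "g dvd 24" "g dvd int p - 1"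
      by (simp_all add: g_def)
    ultimately show "g dvd 2 * k"
      by (metis dvd_diff dvd_mult2 dvd_trans)
  next
    assume "g dvd 2 * k"
    then obtain e where e: "2 * k = g * e" by (elim dvdE)
    obtain u v where uv: "u * (int p - 1) + v * 24 = g"
      using bezout_int unfolding g_def by blast
    \<comment> \<open>With \<open>s = 2 k - r\<close>, the sum \<open>p r + s\<close> is
      \<open>g e + (p - 1) r\<close>; this \<open>r\<close> removes the Bezout term with
      \<open>p - 1\<close> and leaves \<open>24 v e\<close>.\<close>
    define r where "r = - (u * e)"
    have "int p * r + (2 * k - r) = 24 * (v * e)"
      unfolding e uv [symmetric] by (simp add: r_def algebra_simps)
    hence "weakly_holomorphic_modular_form p k
       (\<lambda>z. dedekind_eta z powi r * dedekind_eta (of_nat p * z) powi (2 * k - r))"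
      by (intro eta_quotient_weakly_holomorphic[OF assms]) auto
    thus "\<exists>r s. weakly_holomorphic_modular_form p k
            (\<lambda>z. dedekind_eta z powi r * dedekind_eta (of_nat p * z) powi s)"
      by blast
  qed
  thus ?thesis using dvd_iff by (simp add: g_def)
qed

end
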